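(* Let $\mu(t)$ be the deformation $d\mu(t,z)=\exp\big(\sum_{j\ge1}(t_{1j}z^j-t_{2j}z^{-j})\big)d\mu(z)$ of a quasi-definite complex Borel measure $\mu$ on $\mathbb T$. In the CMV ordering ($\vec n=(1,1)$) the Lax equations $\partial L_a/\partial t_{bj}=[B_{b,j},L_a]$, $a,b=1,2$, have as a consequence that the Verblunsky coefficients $\alpha_k^{(1)}(t),\alpha_k^{(2)}(t)$ of $\mu(t)$ satisfy the nonlinear dynamical system, for $k=1,2,\dots$, $$\frac{\partial\alpha_k^{(1)}}{\partial t_{11}}=\alpha_{k+1}^{(1)}\big(1-\alpha_k^{(1)}\bar\alpha_k^{(2)}\big),\qquad\frac{\partial\bar\alpha_k^{(2)}}{\partial t_{11}}=-\bar\alpha_{k-1}^{(2)}\big(1-\alpha_k^{(1)}\bar\alpha_k^{(2)}\big),$$ $$\frac{\partial\alpha_k^{(1)}}{\partial t_{21}}=\alpha_{k-1}^{(1)}\big(1-\alpha_k^{(1)}\bar\alpha_k^{(2)}\big),\qquad\frac{\partial\bar\alpha_k^{(2)}}{\partial t_{21}}=-\bar\alpha_{k+1}^{(2)}\big(1-\alpha_k^{(1)}\bar\alpha_k^{(2)}\big).$$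
   Context: $\mathbb T$ is the unit circle; a measure is quasi-definite if all its Toeplitz moment matrices $\big(\oint_{\mathbb T}z^{i-j}d\mu\big)_{i,j=0}^n$, $n\ge0$, are non-singular. Indices start at $0$; $\dagger$ is the conjugate transpose. The complex parameters $t=\{t_{1j},t_{2j}\}_{j\ge1}$ are such that the series $\sum_jt_{aj}z^j$ converge for all $z\in\mathbb C$ and $\mu(t)$ is quasi-definite in the range of $t$ considered. Verblunsky coefficients: $P_l^{(1)}(z,t)$, $P_l^{(2)}(z,t)$ are the unique monic polynomials of degree $l$ with $\oint_{\mathbb T}P_l^{(1)}(z,t)z^{-k}d\mu(t,z)=0$ and $\oint_{\mathbb T}z^k\bar P_l^{(2)}(z^{-1},t)\,d\mu(t,z)=0$ for $0\le k\le l-1$, where the bar on $P$ conjugates its coefficients; $\alpha_l^{(a)}=P_l^{(a)}(0)$, so $\alpha_0^{(a)}=1$; $\bar\alpha_l^{(2)}$ is the complex conjugate of $\alpha_l^{(2)}$ (it is a holomorphic function of $t$). Lax matrices: $\chi(z)=(1,z^{-1},z,z^{-2},\dots)^\top$; $g(t)=\oint_{\mathbb T}\chi\chi^\dagger d\mu(t,z)=S_1(t)^{-1}S_2(t)$ with $S_1$ lower unitriangular and $S_2$ upper triangular; $\Upsilon$ is the $0/1$ matrix with non-zero entries $\Upsilon_{2j,2j+2}=\Upsilon_{2j+3,2j+1}=1$ ($j\ge0$) and $\Upsilon_{1,0}=1$; $L_1=S_1\Upsilon S_1^{-1}$, $L_2=S_2\Upsilon^\top S_2^{-1}$; $B_{1,j}=(L_1^j)_+$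 (upper triangular part including the diagonal), $B_{2,j}=(L_2^j)_-$ (strictly lower triangular part). *)

theory Defs
  imports
    "HOL-Analysis.Analysis"
    "HOL-Computational_Algebra.Polynomial"
    "Jordan_Normal_Form.Determinant"
begin

section \<open>Complex Borel measures on the unit circle\<close>

abbreviation circle :: "complex measure" where
  "circle \<equiv> restrict_space borel (sphere 0 1)"

text \<open>A complex measure is a complex-valued countably additive function on the
  measurable sets; additivity on the constantly empty family gives the value 0 on the empty set.\<close>

definition complex_measure :: "'a measure \<Rightarrow> ('a set \<Rightarrow> complex) \<Rightarrow> bool" where
  "complex_measure M \<nu> \<longleftrightarrow>
    (\<forall>A :: nat \<Rightarrow> 'a set. range A \<subseteq> sets M \<longrightarrow> disjoint_family A \<longrightarrow>
      (\<lambda>i. \<nu> (A i)) sums \<nu> (\<Union>i. A i))"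

text \<open>Positive variation of a real-valued signed measure \<open>u\<close>: the set function
  \<open>A \<mapsto> sup {u B | B \<subseteq> A measurable}\<close> is a finite positive measure
  (note that \<open>B = {}\<close> contributes 0, so that negative values cut off by
  \<open>ennreal\<close> are irrelevant). The negative variation of \<open>u\<close> is the positive
  variation of \<open>- u\<close>, and \<open>u\<close> is their difference (Jordan decomposition).\<close>

definition pos_variation :: "'a measure \<Rightarrow> ('a set \<Rightarrow> real) \<Rightarrow> 'a measure" where
  "pos_variation M u =
    measure_of (space M) (sets M) (\<lambda>A. SUP B \<in> {B \<in> sets M. B \<subseteq> A}. ennreal (u B))"

definition signed_integral :: "'a measure \<Rightarrow> ('a set \<Rightarrow> real) \<Rightarrow> ('a \<Rightarrow> complex) \<Rightarrow> complex" where
  "signed_integral M u f =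
    integral\<^sup>L (pos_variation M u) f - integral\<^sup>L (pos_variation M (\<lambda>A. - u A)) f"

definition complex_integral :: "'a measure \<Rightarrow> ('a set \<Rightarrow> complex) \<Rightarrow> ('a \<Rightarrow> complex) \<Rightarrow> complex" where
  "complex_integral M \<nu> f =
    signed_integral M (\<lambda>A. Re (\<nu> A)) f + \<i> * signed_integral M (\<lambda>A. Im (\<nu> A)) f"

abbreviation circle_integral :: "(complex set \<Rightarrow> complex) \<Rightarrow> (complex \<Rightarrow> complex) \<Rightarrow> complex" where
  "circle_integral \<equiv> complex_integral circle"

definition quasi_definite :: "(complex set \<Rightarrow> complex) \<Rightarrow> bool" where
  "quasi_definite \<nu> \<longleftrightarrow>
    (\<forall>n. Determinant.det (mat (Suc n) (Suc n)
      (\<lambda>(i, j). circle_integral \<nu> (\<lambda>z. z powi (int i - int j)))) \<noteq> 0)"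


section \<open>The deformation\<close>

text \<open>The parameters \<open>t\<^sub>a\<^sub>j\<close> are represented by \<open>t a j\<close> with \<open>a \<in> {1, 2}\<close> and \<open>j \<ge> 1\<close>;
  no other values of \<open>t\<close> are used.\<close>

definition admissible :: "(nat \<Rightarrow> nat \<Rightarrow> complex) \<Rightarrow> bool" where
  "admissible t \<longleftrightarrow> (\<forall>a\<in>{1, 2}. \<forall>z. summable (\<lambda>j. t a (Suc j) * z ^ Suc j))"

definition deformed ::
    "(complex set \<Rightarrow> complex) \<Rightarrow> (nat \<Rightarrow> nat \<Rightarrow> complex) \<Rightarrow> complex set \<Rightarrow> complex" where
  "deformed \<mu> t A = circle_integral \<mu> (\<lambda>z. indicator A z *
     exp (\<Sum>j. t 1 (Suc j) * z ^ Suc j - t 2 (Suc j) * inverse z ^ Suc j))"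

definition param_range :: "(complex set \<Rightarrow> complex) \<Rightarrow> (nat \<Rightarrow> nat \<Rightarrow> complex) set" where
  "param_range \<mu> = {t. admissible t \<and> quasi_definite (deformed \<mu> t)}"

definition set_param ::
    "(nat \<Rightarrow> nat \<Rightarrow> complex) \<Rightarrow> nat \<Rightarrow> nat \<Rightarrow> complex \<Rightarrow> nat \<Rightarrow> nat \<Rightarrow> complex" where
  "set_param t b j s = t(b := (t b)(j := s))"


section \<open>Verblunsky coefficients\<close>

definition szego_poly1 :: "(complex set \<Rightarrow> complex) \<Rightarrow> nat \<Rightarrow> complex poly" where
  "szego_poly1 \<nu> l = (THE p. degree p = l \<and> lead_coeff p = 1 \<and>
    (\<forall>k<l. circle_integral \<nu> (\<lambda>z. poly p z * inverse z ^ k) = 0))"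

definition szego_poly2 :: "(complex set \<Rightarrow> complex) \<Rightarrow> nat \<Rightarrow> complex poly" where
  "szego_poly2 \<nu> l = (THE p. degree p = l \<and> lead_coeff p = 1 \<and>
    (\<forall>k<l. circle_integral \<nu> (\<lambda>z. z ^ k * poly (map_poly cnj p) (inverse z)) = 0))"

definition verblunsky1 :: "(complex set \<Rightarrow> complex) \<Rightarrow> nat \<Rightarrow> complex" where
  "verblunsky1 \<nu> l = poly (szego_poly1 \<nu> l) 0"

definition verblunsky2 :: "(complex set \<Rightarrow> complex) \<Rightarrow> nat \<Rightarrow> complex" where
  "verblunsky2 \<nu> l = poly (szego_poly2 \<nu> l) 0"


section \<open>Semi-infinite matrices\<close>

type_synonym imat = "nat \<Rightarrow> nat \<Rightarrow> complex"

text \<open>In every product formed below, each of the sums has only finitely many non-zero terms.\<close>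

definition imat_mult :: "imat \<Rightarrow> imat \<Rightarrow> imat"  (infixl "\<odot>" 70) where
  "(A \<odot> B) i j = (\<Sum>k. A i k * B k j)"

definition imat_one :: imat where
  "imat_one i j = (if i = j then 1 else 0)"

text \<open>Only applied to lower or upper triangular matrices with non-vanishing diagonal; these have
  exactly one two-sided inverse, which is triangular of the same kind.\<close>

definition imat_inv :: "imat \<Rightarrow> imat" where
  "imat_inv A = (THE B. A \<odot> B = imat_one \<and> B \<odot> A = imat_one)"

fun imat_pow :: "imat \<Rightarrow> nat \<Rightarrow> imat" where
  "imat_pow A 0 = imat_one"
| "imat_pow A (Suc n) = A \<odot> imat_pow A n"

definition imat_transpose :: "imat \<Rightarrow> imat" where
  "imat_transpose A i j = A j i"

definition commutator :: "imat \<Rightarrow> imat \<Rightarrow> imat" where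
  "commutator A B i j = (A \<odot> B) i j - (B \<odot> A) i j"

definition upper_part :: "imat \<Rightarrow> imat" where
  "upper_part A i j = (if i \<le> j then A i j else 0)"

definition strict_lower_part :: "imat \<Rightarrow> imat" where
  "strict_lower_part A i j = (if j < i then A i j else 0)"

definition lower_unitriangular :: "imat \<Rightarrow> bool" where
  "lower_unitriangular A \<longleftrightarrow> (\<forall>i. A i i = 1) \<and> (\<forall>i j. i < j \<longrightarrow> A i j = 0)"

definition upper_triang :: "imat \<Rightarrow> bool" where
  "upper_triang A \<longleftrightarrow> (\<forall>i j. j < i \<longrightarrow> A i j = 0)"


section \<open>Lax matrices in the CMV ordering\<close>

definition cmv_chi :: "complex \<Rightarrow> nat \<Rightarrow> complex" where
  "cmv_chi z i = (if even i then z ^ (i div 2) else inverse z ^ (Suc i div 2))"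

definition cmv_moment :: "(complex set \<Rightarrow> complex) \<Rightarrow> imat" where
  "cmv_moment \<nu> i j = circle_integral \<nu> (\<lambda>z. cmv_chi z i * cnj (cmv_chi z j))"

definition gauss_borel :: "(complex set \<Rightarrow> complex) \<Rightarrow> imat \<times> imat" where
  "gauss_borel \<nu> = (THE (S1, S2). lower_unitriangular S1 \<and> upper_triang S2 \<and>
    cmv_moment \<nu> = imat_inv S1 \<odot> S2)"

definition cmv_shift :: imat where
  "cmv_shift i j =
    (if (\<exists>k. i = 2 * k \<and> j = 2 * k + 2) \<or> (\<exists>k. i = 2 * k + 3 \<and> j = 2 * k + 1) \<or> (i = 1 \<and> j = 0)
     then 1 else 0)"

definition lax1 :: "(complex set \<Rightarrow> complex) \<Rightarrow> imat" where
  "lax1 \<nu> = (case gauss_borel \<nu> of (S1, S2) \<Rightarrow> S1 \<odot> cmv_shift \<odot> imat_inv S1)"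

definition lax2 :: "(complex set \<Rightarrow> complex) \<Rightarrow> imat" where
  "lax2 \<nu> = (case gauss_borel \<nu> of (S1, S2) \<Rightarrow> S2 \<odot> imat_transpose cmv_shift \<odot> imat_inv S2)"

definition lax :: "nat \<Rightarrow> (complex set \<Rightarrow> complex) \<Rightarrow> imat" where
  "lax a \<nu> = (if a = 1 then lax1 \<nu> else lax2 \<nu>)"

definition lax_B :: "nat \<Rightarrow> nat \<Rightarrow> (complex set \<Rightarrow> complex) \<Rightarrow> imat" where
  "lax_B b j \<nu> =
    (if b = 1 then upper_part (imat_pow (lax1 \<nu>) j) else strict_lower_part (imat_pow (lax2 \<nu>) j))"

text \<open>The Lax equations, entry by entry, at the parameter value \<open>t\<close>.
  The matrices \<open>L\<^sub>a\<close> exist only on the range where \<open>\<mu>(t)\<close> is quasi-definite, so the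
  derivative is taken within that range. When \<open>t\<close> belongs to the range, the values of a single
  parameter that lead out of it are the zeros of countably many entire functions, none of
  them identically zero; hence \<open>t b j\<close> is a limit point of the allowed values and the
  derivative is uniquely determined.\<close>

definition lax_equations ::
    "(complex set \<Rightarrow> complex) \<Rightarrow> (nat \<Rightarrow> nat \<Rightarrow> complex) \<Rightarrow> bool" where
  "lax_equations \<mu> t \<longleftrightarrow>
    (\<forall>a\<in>{1, 2}. \<forall>b\<in>{1, 2}. \<forall>j\<ge>1. \<forall>m n.
      ((\<lambda>s. lax a (deformed \<mu> (set_param t b j s)) m n) has_field_derivative
        commutator (lax_B b j (deformed \<mu> t)) (lax a (deformed \<mu> t)) m n)
      (at (t b j) within {s. set_param t b j s \<in> param_range \<mu>}))"

end

theory Submission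
  imports Defs
begin

text \<open>Write \<open>c n\<close> for the moments of \<open>\<mu>(t)\<close>. All objects of the theorem are functions of these numbers,
and a flow acts on them linearly: \<open>\<partial>c n / \<partial>t\<^sub>1\<^sub>j = c (n + j)\<close> and
\<open>\<partial>c n / \<partial>t\<^sub>2\<^sub>j = - c (n - j)\<close> (lemma \<open>has_field_derivative_moment\<close>). The analytic part of the
proof is to justify this. The variations of \<open>\<mu>\<close> are shown to be finite measures, so that
\<open>\<mu>\<close> has an integrable density \<open>\<rho>\<close> with respect to one finite positive measure \<open>m\<close>; then \<open>\<mu>(t)\<close> has
density \<open>w \<rho>\<close> with the exponential weight \<open>w\<close>, all its integrals are integrals over \<open>m\<close>, and one
differentiates under the integral sign.

For the Lax equations, let \<open>g\<close> be the CMV moment matrix and \<open>S g = U\<close> its Gauss-Borel factorization.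
It exists and is unique because the leading blocks of \<open>g\<close> are permuted Toeplitz blocks, and Gaussian
elimination gives the entries of \<open>S\<close> and \<open>U\<close> as rational functions of finitely many moments, hence
differentiable ones. The moment flow reads \<open>g' = \<Upsilon>\<^sup>j g\<close> or \<open>g' = - g (\<Upsilon>\<^sup>T)\<^sup>j\<close>. Differentiating
\<open>S g = U\<close> and multiplying by the inverse of \<open>U\<close> turns this into
\<open>U' U\<^sup>-\<^sup>1 = S' S\<^sup>-\<^sup>1 + L\<^sub>1\<^sup>j\<close> or \<open>U' U\<^sup>-\<^sup>1 = S' S\<^sup>-\<^sup>1 - L\<^sub>2\<^sup>j\<close>. As \<open>U' U\<^sup>-\<^sup>1\<close> is upper
triangular and \<open>S' S\<^sup>-\<^sup>1\<close> strictly lower triangular, both are read off as the triangular parts of the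
power of the Lax matrix. Since \<open>L\<^sub>1\<close> is a conjugate of \<open>\<Upsilon>\<close> by \<open>S\<close> and \<open>L\<^sub>2\<close> one of \<open>\<Upsilon>\<^sup>T\<close> by \<open>U\<close>,
their derivatives are the commutators with \<open>S' S\<^sup>-\<^sup>1\<close> and \<open>U' U\<^sup>-\<^sup>1\<close> (lemmas
\<open>conjugation_derivative\<close> and \<open>lax_derivative\<close>).

The system for the Verblunsky coefficients is derived here from the orthogonality relations
themselves, which state the same triangularity for the Toeplitz matrix of the moments. Let \<open>P\<^sub>l\<close> be the
polynomials \<open>P\<^sub>l\<^sup>(\<^sup>1\<^sup>)\<close>, \<open>Q\<^sub>l\<close> the polynomials \<open>P\<^sub>l\<^sup>(\<^sup>2\<^sup>)\<close> with conjugated coefficients, \<open>\<alpha>\<^sub>l\<close> and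
\<open>\<beta>\<^sub>l\<close> their constant terms and \<open>h\<^sub>l\<close> the integral of \<open>z\<^sup>l Q\<^sub>l(1/z)\<close>. Differentiating the
relations that define \<open>P\<^sub>l\<close> along \<open>t\<^sub>1\<^sub>1\<close> shows that \<open>\<partial>P\<^sub>l\<close>, a polynomial of degree below \<open>l\<close>,
satisfies all of them but the first again, and this makes it a multiple of the reversed polynomial
\<open>z\<^sup>l\<^sup>-\<^sup>1 Q\<^sub>l\<^sub>-\<^sub>1(1/z)\<close>; similarly \<open>\<partial>Q\<^sub>l\<close> is a multiple of \<open>Q\<^sub>l\<^sub>-\<^sub>1\<close>. The factors are found from
the Szego recursion and from
\<open>h\<^sub>l = h\<^sub>l\<^sub>-\<^sub>1 (1 - \<alpha>\<^sub>l \<beta>\<^sub>l)\<close>, and the constant terms give the equations (lemmas \<open>alpha_flow\<close>,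
\<open>beta_flow\<close>). The map \<open>z \<mapsto> 1/z\<close> exchanges the two families of polynomials and, up to sign, the two
flows, so that the two equations for \<open>t\<^sub>1\<^sub>1\<close> also yield those for \<open>t\<^sub>2\<^sub>1\<close>.\<close>

section \<open>Signed measures and their variations\<close>

definition signed_measure :: "'a measure \<Rightarrow> ('a set \<Rightarrow> real) \<Rightarrow> bool" where
  "signed_measure M u \<longleftrightarrow>
    (\<forall>A :: nat \<Rightarrow> 'a set. range A \<subseteq> sets M \<longrightarrow> disjoint_family A \<longrightarrow>
      (\<lambda>i. u (A i)) sums u (\<Union>i. A i))"

lemma signed_measure_uminus: "signed_measure M u \<Longrightarrow> signed_measure M (\<lambda>A. - u A)"
  by (auto simp: signed_measure_def intro: sums_minus)

lemma signed_measure_empty: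
  assumes "signed_measure M u"
  shows "u {} = 0"
proof -
  have "(\<lambda>i::nat. u {}) sums u {}"
    using assms[unfolded signed_measure_def, rule_format, of "\<lambda>_. {}"]
    by (auto simp: disjoint_family_on_def)
  then have "summable (\<lambda>i::nat. u {})" by (rule sums_summable)
  then show ?thesis by (simp add: summable_const_iff)
qed

lemma signed_measure_Un:
  assumes "signed_measure M u" "A \<in> sets M" "B \<in> sets M" "A \<inter> B = {}"
  shows "u (A \<union> B) = u A + u B"
proof -
  have r: "range (binaryset A B) \<subseteq> sets M"
    using assms by (auto simp: range_binaryset_eq)
  have d: "disjoint_family (binaryset A B)"
    using assms(4) by (auto simp: disjoint_family_on_def binaryset_def)
  have "(\<lambda>i. u (binaryset A B i)) sums u (A \<union> B)"
    using assms(1)[unfolded signed_measure_def, rule_format, OF r d] by (simp add: UN_binaryset_eq)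
  moreover have "(\<lambda>i. u (binaryset A B i)) sums (\<Sum>i<2. u (binaryset A B i))"
    by (rule sums_finite) (auto simp: binaryset_def signed_measure_empty[OF assms(1)])
  ultimately have "u (A \<union> B) = (\<Sum>i<2. u (binaryset A B i))" by (rule sums_unique2)
  then show ?thesis by (simp add: binaryset_def numeral_2_eq_2)
qed

lemma signed_measure_Diff:
  assumes "signed_measure M u" "A \<in> sets M" "B \<in> sets M" "B \<subseteq> A"
  shows "u (A - B) = u A - u B"
proof -
  have "u (B \<union> (A - B)) = u B + u (A - B)"
    using assms by (intro signed_measure_Un) auto
  moreover have "B \<union> (A - B) = A" using assms by auto
  ultimately show ?thesis by simp
qed

text \<open>If \<open>u\<close> were unbounded, a set on which it is unbounded could be split into two parts on
  which it exceeds 1 in absolute value, one of them again with unbounded \<open>u\<close>. Repeating the split on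
  that part peels off infinitely many disjoint sets with \<open>\<bar>u\<bar> > 1\<close>, against the convergence of
  the sum of their values.\<close>

lemma signed_measure_bounded:
  assumes u: "signed_measure M u"
  shows "\<exists>C. \<forall>B\<in>sets M. \<bar>u B\<bar> \<le> C"
proof (rule ccontr)
  define unb where "unb A \<longleftrightarrow> A \<in> sets M \<and> (\<forall>C. \<exists>B\<in>sets M. B \<subseteq> A \<and> C < \<bar>u B\<bar>)" for A
  assume "\<not> ?thesis"
  then have "unb (space M)"
    unfolding unb_def by (meson linorder_not_le sets.sets_into_space sets.top)
  have split: "\<exists>B. unb B \<and> B \<subseteq> A \<and> 1 < \<bar>u (A - B)\<bar>" if A: "unb A" for A
  proof -
    obtain B where B: "B \<in> sets M" "B \<subseteq> A" "\<bar>u A\<bar> + 1 < \<bar>u B\<bar>"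
      using A unfolding unb_def by blast
    have AM: "A \<in> sets M" using A by (simp add: unb_def)
    have d: "u (A - B) = u A - u B"
      by (rule signed_measure_Diff[OF u AM B(1,2)])
    have "unb B \<or> unb (A - B)"
    proof (rule ccontr)
      assume "\<not> ?thesis"
      moreover have "A - B \<in> sets M" using AM B by auto
      ultimately obtain C1 C2 where
        C1: "\<And>E. E \<in> sets M \<Longrightarrow> E \<subseteq> B \<Longrightarrow> \<bar>u E\<bar> \<le> C1" and
        C2: "\<And>E. E \<in> sets M \<Longrightarrow> E \<subseteq> A - B \<Longrightarrow> \<bar>u E\<bar> \<le> C2"
        unfolding unb_def using B(1) by (meson linorder_not_le)
      obtain E where E: "E \<in> sets M" "E \<subseteq> A" "C1 + C2 < \<bar>u E\<bar>"
        using A unfolding unb_def by blast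
      have "u ((E \<inter> B) \<union> (E - B)) = u (E \<inter> B) + u (E - B)"
        using E B by (intro signed_measure_Un[OF u]) auto
      moreover have "(E \<inter> B) \<union> (E - B) = E" by auto
      ultimately have "u E = u (E \<inter> B) + u (E - B)" by simp
      moreover have "\<bar>u (E \<inter> B)\<bar> \<le> C1" using E B by (intro C1) auto
      moreover have "\<bar>u (E - B)\<bar> \<le> C2" using E B by (intro C2) auto
      ultimately show False using E(3) by linarith
    qed
    then show ?thesis
    proof
      assume "unb B"
      then show ?thesis using B d by (intro exI[of _ B]) auto
    next
      assume "unb (A - B)"
      moreover have "A - (A - B) = B" using B by auto
      ultimately show ?thesis using B by (intro exI[of _ "A - B"]) auto
    qed
  qed
  obtain A where A: "unb (A n)" "A (Suc n) \<subseteq> A n" "1 < \<bar>u (A n - A (Suc n))\<bar>" for n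
    using dependent_nat_choice[of "\<lambda>_. unb" "\<lambda>_ A B. B \<subseteq> A \<and> 1 < \<bar>u (A - B)\<bar>"]
      \<open>unb (space M)\<close> split by metis
  have dec: "A m \<subseteq> A n" if "n \<le> m" for m n
    using A(2) that by (simp add: lift_Suc_antimono_le)
  have AM: "A n \<in> sets M" for n using A(1) by (simp add: unb_def)
  have "disjoint_family (\<lambda>n. A n - A (Suc n))"
    unfolding disjoint_family_on_def
  proof (intro ballI impI)
    fix m n :: nat assume "m \<noteq> n"
    then consider "Suc m \<le> n" | "Suc n \<le> m" by linarith
    then show "(A m - A (Suc m)) \<inter> (A n - A (Suc n)) = {}"
      using dec by cases blast+
  qed
  moreover have "range (\<lambda>n. A n - A (Suc n)) \<subseteq> sets M" using AM by auto
  ultimately have "summable (\<lambda>n. u (A n - A (Suc n)))"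
    using u unfolding signed_measure_def by (blast intro: sums_summable)
  then have "(\<lambda>n. \<bar>u (A n - A (Suc n))\<bar>) \<longlonglongrightarrow> 0"
    using summable_LIMSEQ_zero tendsto_rabs_zero by blast
  then have "\<forall>\<^sub>F n in sequentially. \<bar>u (A n - A (Suc n))\<bar> < 1"
    by (rule order_tendstoD) simp
  then show False
    using A(3) unfolding eventually_sequentially by (meson less_asym order_refl)
qed

text \<open>The set function from which \<open>pos_variation\<close> builds its measure. Finite superadditivity uses unions
of subsets of disjoint sets, countable subadditivity cuts a subset of a union into pieces; together
they make it a measure, and boundedness of \<open>u\<close> makes that measure finite.\<close>

definition pos_sup :: "'a measure \<Rightarrow> ('a set \<Rightarrow> real) \<Rightarrow> 'a set \<Rightarrow> ennreal" where
  "pos_sup M u A = (SUP B \<in> {B \<in> sets M. B \<subseteq> A}. ennreal (u B))"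

lemma pos_sup_upper: "B \<in> sets M \<Longrightarrow> B \<subseteq> A \<Longrightarrow> ennreal (u B) \<le> pos_sup M u A"
  unfolding pos_sup_def by (rule SUP_upper) auto

lemma pos_sup_finite_sum_le:
  fixes A :: "nat \<Rightarrow> 'a set"
  assumes u: "signed_measure M u" and A: "\<And>i. A i \<in> sets M" "disjoint_family A"
  shows "(\<Sum>i<n. pos_sup M u (A i)) \<le> pos_sup M u (\<Union>i<n. A i)"
proof (induction n)
  case (Suc n)
  let ?P = "\<Union>i<n. A i"
  have PM: "?P \<in> sets M" using A by auto
  have disj: "?P \<inter> A n = {}"
  proof -
    have "A i \<inter> A n = {}" if "i < n" for i
      using disjoint_family_onD[OF A(2)] that by simp
    then show ?thesis by blast
  qed
  have add: "pos_sup M u ?P + pos_sup M u (A n) \<le> pos_sup M u (?P \<union> A n)"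
  proof -
    have le: "ennreal (u B) + ennreal (u C) \<le> pos_sup M u (?P \<union> A n)"
      if B: "B \<in> sets M" "B \<subseteq> ?P" and C: "C \<in> sets M" "C \<subseteq> A n" for B C
    proof -
      have *: "ennreal (u B) \<le> pos_sup M u (?P \<union> A n)" "ennreal (u C) \<le> pos_sup M u (?P \<union> A n)"
          "ennreal (u (B \<union> C)) \<le> pos_sup M u (?P \<union> A n)"
        by (rule pos_sup_upper[OF B(1) le_supI1[OF B(2)]] pos_sup_upper[OF C(1) le_supI2[OF C(2)]]
            pos_sup_upper[OF sets.Un[OF B(1) C(1)] Un_mono[OF B(2) C(2)]])+
      have add: "u (B \<union> C) = u B + u C"
        by (rule signed_measure_Un[OF u B(1) C(1)]) (use B(2) C(2) disj in blast)
      consider "0 \<le> u B" "0 \<le> u C" | "u B \<le> 0" | "u C \<le> 0" by linarith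
      then show ?thesis
        using * by cases (simp_all add: add ennreal_neg flip: ennreal_plus)
    qed
    have "pos_sup M u ?P + pos_sup M u (A n) =
        (SUP B\<in>{B \<in> sets M. B \<subseteq> ?P}. ennreal (u B) + pos_sup M u (A n))"
      unfolding pos_sup_def[of M u ?P] by (rule ennreal_SUP_add_left[symmetric]) blast
    also have "\<dots> \<le> pos_sup M u (?P \<union> A n)"
    proof (rule SUP_least)
      fix B assume B: "B \<in> {B \<in> sets M. B \<subseteq> ?P}"
      have "ennreal (u B) + pos_sup M u (A n) =
          (SUP C\<in>{C \<in> sets M. C \<subseteq> A n}. ennreal (u B) + ennreal (u C))"
        unfolding pos_sup_def[of M u "A n"] by (rule ennreal_SUP_add_right) blast
      also have "\<dots> \<le> pos_sup M u (?P \<union> A n)"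
        by (rule SUP_least) (use le B in simp)
      finally show "ennreal (u B) + pos_sup M u (A n) \<le> pos_sup M u (?P \<union> A n)" .
    qed
    finally show ?thesis .
  qed
  have eq: "(\<Union>i<Suc n. A i) = ?P \<union> A n" by (simp add: lessThan_Suc Un_commute)
  have "(\<Sum>i<Suc n. pos_sup M u (A i)) \<le> pos_sup M u ?P + pos_sup M u (A n)"
    using Suc.IH by (simp add: add_right_mono)
  also note add
  finally show ?case unfolding eq .
qed simp

lemma pos_sup_suminf:
  fixes A :: "nat \<Rightarrow> 'a set"
  assumes u: "signed_measure M u" and A: "range A \<subseteq> sets M" "disjoint_family A"
  shows "(\<Sum>i. pos_sup M u (A i)) = pos_sup M u (\<Union>i. A i)"
proof (rule antisym)
  have AM: "A i \<in> sets M" for i using A by auto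
  have "(\<Sum>i<n. pos_sup M u (A i)) \<le> pos_sup M u (\<Union>i. A i)" for n
  proof -
    have "pos_sup M u (\<Union>i<n. A i) \<le> pos_sup M u (\<Union>i. A i)"
      unfolding pos_sup_def by (rule SUP_subset_mono) auto
    then show ?thesis
      using pos_sup_finite_sum_le[OF u AM A(2)] order_trans by blast
  qed
  then show "(\<Sum>i. pos_sup M u (A i)) \<le> pos_sup M u (\<Union>i. A i)"
    by (intro suminf_le_const) auto
  show "pos_sup M u (\<Union>i. A i) \<le> (\<Sum>i. pos_sup M u (A i))"
    unfolding pos_sup_def[of M u "\<Union>i. A i"]
  proof (rule SUP_least)
    fix B assume "B \<in> {B \<in> sets M. B \<subseteq> (\<Union>i. A i)}"
    then have B: "B \<in> sets M" "B \<subseteq> (\<Union>i. A i)" by auto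
    have "(\<lambda>i. u (B \<inter> A i)) sums u (\<Union>i. B \<inter> A i)"
      using A B by (intro u[unfolded signed_measure_def, rule_format])
        (auto simp: disjoint_family_on_def)
    moreover have "(\<Union>i. B \<inter> A i) = B" using B by auto
    ultimately have "(\<lambda>i. u (B \<inter> A i)) sums u B" by simp
    then have lim: "(\<lambda>n. ennreal (\<Sum>i<n. u (B \<inter> A i))) \<longlonglongrightarrow> ennreal (u B)"
      by (intro tendsto_ennrealI) (simp add: sums_def)
    have "ennreal (\<Sum>i<n. u (B \<inter> A i)) \<le> (\<Sum>i. pos_sup M u (A i))" for n
    proof -
      have "ennreal (\<Sum>i<n. u (B \<inter> A i)) \<le> ennreal (\<Sum>i<n. max 0 (u (B \<inter> A i)))"
        by (intro ennreal_leI sum_mono) auto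
      also have "\<dots> = (\<Sum>i<n. ennreal (max 0 (u (B \<inter> A i))))"
        by (rule sum_ennreal[symmetric]) auto
      also have "\<dots> = (\<Sum>i<n. ennreal (u (B \<inter> A i)))"
        by (intro sum.cong refl) (auto simp: max_def ennreal_neg)
      also have "\<dots> \<le> (\<Sum>i<n. pos_sup M u (A i))"
        using B AM by (intro sum_mono pos_sup_upper) auto
      also have "\<dots> \<le> (\<Sum>i. pos_sup M u (A i))"
        by (intro sum_le_suminf) auto
      finally show ?thesis .
    qed
    then show "ennreal (u B) \<le> (\<Sum>i. pos_sup M u (A i))"
      using lim by (intro LIMSEQ_le_const2[OF lim]) auto
  qed
qed

lemma sets_pos_variation [simp]: "sets (pos_variation M u) = sets M"
  and space_pos_variation [simp]: "space (pos_variation M u) = space M"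
  unfolding pos_variation_def by simp_all

lemma emeasure_pos_variation:
  assumes "signed_measure M u" "A \<in> sets M"
  shows "emeasure (pos_variation M u) A = pos_sup M u A"
proof (rule emeasure_measure_of)
  show "pos_variation M u = measure_of (space M) (sets M) (pos_sup M u)"
    by (simp add: pos_variation_def pos_sup_def[abs_def])
  show "positive (sets (pos_variation M u)) (pos_sup M u)"
    by (auto simp: positive_def pos_sup_def signed_measure_empty[OF assms(1)] subset_empty
        cong: conj_cong)
  show "countably_additive (sets (pos_variation M u)) (pos_sup M u)"
    using pos_sup_suminf[OF assms(1)] by (auto simp: countably_additive_def)
qed (use assms in \<open>auto simp: sets.space_closed\<close>)

lemma pos_sup_finite:
  assumes "signed_measure M u"
  shows "pos_sup M u A < \<infinity>"
proof -
  obtain C where C: "\<And>B. B \<in> sets M \<Longrightarrow> \<bar>u B\<bar> \<le> C"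
    using signed_measure_bounded[OF assms] by blast
  have "pos_sup M u A \<le> ennreal C"
    unfolding pos_sup_def using C by (intro SUP_least ennreal_leI) (auto simp: abs_le_iff)
  also have "\<dots> < \<infinity>" by simp
  finally show ?thesis .
qed

lemma finite_measure_pos_variation:
  assumes "signed_measure M u"
  shows "finite_measure (pos_variation M u)"
  by (rule finite_measureI)
    (use pos_sup_finite[OF assms] in \<open>simp add: emeasure_pos_variation[OF assms] less_top\<close>)

text \<open>Passing to complements, \<open>u B = u A - u (A - B)\<close> for \<open>B \<subseteq> A\<close>, so the supremum of \<open>u\<close> over the subsets
of \<open>A\<close> is \<open>u A\<close> plus the supremum of \<open>- u\<close>. Finiteness of both suprema allows the subtraction.\<close>

lemma jordan_decomposition:
  assumes u: "signed_measure M u" and A: "A \<in> sets M"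
  shows "u A = measure (pos_variation M u) A - measure (pos_variation M (\<lambda>A. - u A)) A"
proof -
  note u' = signed_measure_uminus[OF u]
  have half: "measure (pos_variation M v) A \<le> v A + measure (pos_variation M (\<lambda>A. - v A)) A"
    if v: "signed_measure M v" for v
  proof -
    note v' = signed_measure_uminus[OF v]
    let ?n = "measure (pos_variation M (\<lambda>A. - v A)) A"
    have n: "pos_sup M (\<lambda>A. - v A) A = ennreal ?n"
      using finite_measure.emeasure_eq_measure[OF finite_measure_pos_variation[OF v'], of A]
      by (simp add: emeasure_pos_variation[OF v' A])
    have le: "v B \<le> v A + ?n" if B: "B \<in> sets M" "B \<subseteq> A" for B
    proof -
      have "ennreal (- v (A - B)) \<le> ennreal ?n"
        unfolding n[symmetric] using A B by (intro pos_sup_upper[where u = "\<lambda>A. - v A"]) auto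
      then have "- v (A - B) \<le> ?n" by (simp add: ennreal_le_iff)
      then show ?thesis using signed_measure_Diff[OF v A B] by simp
    qed
    have "0 \<le> v A + ?n" using le[of "{}"] signed_measure_empty[OF v] by simp
    moreover have "pos_sup M v A \<le> ennreal (v A + ?n)"
      unfolding pos_sup_def using le by (intro SUP_least ennreal_leI) auto
    moreover have "pos_sup M v A = ennreal (measure (pos_variation M v) A)"
      using finite_measure.emeasure_eq_measure[OF finite_measure_pos_variation[OF v], of A]
      by (simp add: emeasure_pos_variation[OF v A])
    ultimately show ?thesis by (simp add: ennreal_le_iff)
  qed
  show ?thesis using half[OF u] half[OF u'] by simp
qed

section \<open>Complex measures as densities\<close>

lemma integrable_indicator_times:
  fixes h :: "'a \<Rightarrow> complex"
  assumes "A \<in> sets m" "integrable m h"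
  shows "integrable m (\<lambda>x. indicator A x * h x)"
proof -
  have "(\<lambda>x. indicator A x * h x) = (\<lambda>x. indicator A x *\<^sub>R h x)"
    by (auto simp: indicator_def)
  then show ?thesis using integrable_mult_indicator[OF assms] by simp
qed

lemma bounded_density_exists:
  assumes m: "finite_measure m" and N: "finite_measure N"
    and sets [measurable_cong]: "sets N = sets m"
    and le: "\<And>A. A \<in> sets m \<Longrightarrow> emeasure N A \<le> emeasure m A"
  obtains D :: "'a \<Rightarrow> real" where "integrable m D"
    "\<And>A. A \<in> sets m \<Longrightarrow> measure N A = (\<integral>x. indicator A x * D x \<partial>m)"
proof -
  interpret m: finite_measure m by (rule m)
  interpret N: finite_measure N by (rule N)
  have ac: "absolutely_continuous m N"
    unfolding absolutely_continuous_def null_sets_def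
    using le sets by (fastforce simp: le_zero_eq[symmetric] simp del: le_zero_eq)
  obtain D where D [measurable]: "D \<in> borel_measurable m"
    and RN: "AE x in m. RN_deriv m N x = ennreal (D x)" and pos: "\<And>x. 0 \<le> D x"
    using m.real_RN_deriv[OF N ac sets] by metis
  have dens: "emeasure N A = (\<integral>\<^sup>+x. ennreal (indicator A x * D x) \<partial>m)" if A [measurable]: "A \<in> sets m" for A
  proof -
    have "emeasure N A = emeasure (density m (RN_deriv m N)) A"
      by (simp add: m.density_RN_deriv[OF ac sets])
    also have "\<dots> = (\<integral>\<^sup>+x. RN_deriv m N x * indicator A x \<partial>m)"
      by (rule emeasure_density) (use A in auto)
    also have "\<dots> = (\<integral>\<^sup>+x. ennreal (indicator A x * D x) \<partial>m)"
      by (rule nn_integral_cong_AE) (use RN in \<open>auto simp: indicator_def elim: eventually_mono\<close>)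
    finally show ?thesis .
  qed
  have "(\<integral>\<^sup>+x. ennreal (D x) \<partial>m) = emeasure N (space m)"
    unfolding dens[OF sets.top] by (rule nn_integral_cong) simp
  then have int: "integrable m D"
    using pos N.emeasure_finite[of "space m"]
    by (intro integrableI_nonneg) (auto simp: less_top[symmetric])
  show thesis
  proof (rule that[OF int])
    fix A assume A [measurable]: "A \<in> sets m"
    have "integrable m (\<lambda>x. indicator A x * D x)"
      using integrable_mult_indicator[OF A int] by simp
    then have "emeasure N A = ennreal (\<integral>x. indicator A x * D x \<partial>m)"
      unfolding dens[OF A] using pos by (intro nn_integral_eq_integral) auto
    moreover have "0 \<le> (\<integral>x. indicator A x * D x \<partial>m)"
      using pos by (intro integral_nonneg_AE) auto
    ultimately show "measure N A = (\<integral>x. indicator A x * D x \<partial>m)"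
      by (simp add: measure_def)
  qed
qed

lemma finite_dominating_measure:
  assumes "\<And>i. i < (n::nat) \<Longrightarrow> finite_measure (N i)" "\<And>i. i < n \<Longrightarrow> sets (N i) = sets M"
  obtains m where "finite_measure m" "sets m = sets M"
    "\<And>i A. i < n \<Longrightarrow> A \<in> sets M \<Longrightarrow> emeasure (N i) A \<le> emeasure m A"
proof
  define \<phi> where "\<phi> A = (\<Sum>i<n. emeasure (N i) A)" for A
  define m where "m = measure_of (space M) (sets M) \<phi>"
  show sets: "sets m = sets M" by (simp add: m_def)
  have eq: "emeasure m A = \<phi> A" if "A \<in> sets M" for A
  proof (rule emeasure_measure_of[OF m_def])
    show "positive (sets m) \<phi>" by (simp add: positive_def \<phi>_def)
    show "countably_additive (sets m) \<phi>"
      unfolding countably_additive_def \<phi>_def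
    proof (intro allI impI)
      fix A :: "nat \<Rightarrow> 'a set"
      assume A: "range A \<subseteq> sets m" "disjoint_family A"
      have "(\<Sum>j. \<Sum>i<n. emeasure (N i) (A j)) = (\<Sum>i<n. \<Sum>j. emeasure (N i) (A j))"
        by (rule suminf_sum) simp
      also have "\<dots> = (\<Sum>i<n. emeasure (N i) (\<Union>j. A j))"
        using A assms(2) sets by (intro sum.cong refl suminf_emeasure) auto
      finally show "(\<Sum>j. \<Sum>i<n. emeasure (N i) (A j)) = (\<Sum>i<n. emeasure (N i) (\<Union>j. A j))" .
    qed
  qed (use that in \<open>auto simp: sets.space_closed sets\<close>)
  show "finite_measure m"
  proof (rule finite_measureI)
    have "emeasure (N i) (space M) \<noteq> \<infinity>" if "i < n" for i
      using finite_measure.emeasure_finite[OF assms(1)[OF that]] by simp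
    moreover have "space m = space M" by (simp add: m_def)
    ultimately show "emeasure m (space m) \<noteq> \<infinity>"
      by (simp add: eq \<phi>_def)
  qed
  show "emeasure (N i) A \<le> emeasure m A" if "i < n" "A \<in> sets M" for i A
    unfolding eq[OF that(2)] \<phi>_def using that by (intro member_le_sum) auto
qed

text \<open>The four variations of the real and imaginary part need not be mutually absolutely continuous, but
they are all dominated by their sum. With respect to this one positive measure every complex measure
below has a density, which reduces complex integrals to Bochner integrals.\<close>

definition has_density :: "'a measure \<Rightarrow> ('a set \<Rightarrow> complex) \<Rightarrow> ('a \<Rightarrow> complex) \<Rightarrow> bool" where
  "has_density m \<nu> h \<longleftrightarrow> integrable m h \<and>
    (\<forall>A\<in>sets m. \<nu> A = (\<integral>x. indicator A x * h x \<partial>m))"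

lemma complex_measure_has_density:
  assumes "complex_measure M \<nu>"
  obtains m h where "finite_measure m" "sets m = sets M" "has_density m \<nu> h"
proof -
  define u v where "u A = Re (\<nu> A)" and "v A = Im (\<nu> A)" for A
  have u: "signed_measure M u" and v: "signed_measure M v"
    using assms by (auto simp: complex_measure_def signed_measure_def u_def v_def sums_complex_iff)
  define N where "N i = (if i = 0 then pos_variation M u else if i = 1 then pos_variation M (\<lambda>A. - u A)
    else if i = 2 then pos_variation M v else pos_variation M (\<lambda>A. - v A))" for i :: nat
  have four: "i < 4 \<Longrightarrow> i = 0 \<or> i = 1 \<or> i = 2 \<or> i = 3" for i :: nat by auto
  have fin: "finite_measure (N i)" if "i < 4" for i
    using four[OF that] u v
    by (auto simp: N_def intro!: finite_measure_pos_variation signed_measure_uminus)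
  have sets: "sets (N i) = sets M" if "i < 4" for i
    using four[OF that] by (auto simp: N_def)
  obtain m where m: "finite_measure m" "sets m = sets M"
    "\<And>i A. i < 4 \<Longrightarrow> A \<in> sets M \<Longrightarrow> emeasure (N i) A \<le> emeasure m A"
    using finite_dominating_measure[of 4 N M, OF fin sets] by blast
  have "\<exists>D. integrable m D \<and> (\<forall>A\<in>sets m. measure (N i) A = (\<integral>x. indicator A x * D x \<partial>m))"
    if "i < 4" for i
    using bounded_density_exists[OF m(1) fin[OF that]] sets[OF that] m(2,3) that by metis
  then obtain D where D: "\<And>i. i < 4 \<Longrightarrow> integrable m (D i)"
    "\<And>i A. i < 4 \<Longrightarrow> A \<in> sets M \<Longrightarrow> measure (N i) A = (\<integral>x. indicator A x * D i x \<partial>m)"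
    unfolding m(2) by metis
  define h where "h x = Complex (D 0 x - D 1 x) (D 2 x - D 3 x)" for x
  have h: "h x = of_real (D 0 x - D 1 x) + \<i> * of_real (D 2 x - D 3 x)" for x
    by (simp add: h_def complex_eq_iff)
  have "integrable m h"
    unfolding h using D(1) by (intro Bochner_Integration.integrable_add integrable_mult_right
        integrable_of_real Bochner_Integration.integrable_diff) auto
  moreover have "\<nu> A = (\<integral>x. indicator A x * h x \<partial>m)" if A: "A \<in> sets m" for A
  proof -
    have AM: "A \<in> sets M" using A m(2) by simp
    have iD: "integrable m (\<lambda>x. indicator A x * D i x)" if "i < 4" for i
      using integrable_mult_indicator[OF A D(1)[OF that]] by simp
    have ih: "integrable m (\<lambda>x. indicator A x * h x)"
      by (rule integrable_indicator_times[OF A \<open>integrable m h\<close>])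
    have "Re (\<integral>x. indicator A x * h x \<partial>m) = (\<integral>x. indicator A x * D 0 x - indicator A x * D 1 x \<partial>m)"
      unfolding integral_Re[OF ih, symmetric]
      by (intro Bochner_Integration.integral_cong) (auto simp: h_def indicator_def)
    also have "\<dots> = u A"
      using jordan_decomposition[OF u AM] D(2)[OF _ AM, of 0] D(2)[OF _ AM, of 1] iD
      by (subst Bochner_Integration.integral_diff) (auto simp: N_def)
    finally have re: "Re (\<integral>x. indicator A x * h x \<partial>m) = u A" .
    have "Im (\<integral>x. indicator A x * h x \<partial>m) = (\<integral>x. indicator A x * D 2 x - indicator A x * D 3 x \<partial>m)"
      unfolding integral_Im[OF ih, symmetric]
      by (intro Bochner_Integration.integral_cong) (auto simp: h_def indicator_def)
    also have "\<dots> = v A"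
      using jordan_decomposition[OF v AM] D(2)[OF _ AM, of 2] D(2)[OF _ AM, of 3] iD
      by (subst Bochner_Integration.integral_diff) (auto simp: N_def)
    finally show ?thesis using re by (simp add: complex_eq_iff u_def v_def)
  qed
  ultimately show thesis using that m by (auto simp: has_density_def)
qed

text \<open>The supremum of \<open>\<integral>\<^sub>B h\<close> over \<open>B \<subseteq> A\<close> is attained at \<open>B = {x \<in> A. 0 < h x}\<close>.\<close>

lemma pos_variation_density:
  assumes sets: "sets m = sets M" and h: "integrable m h"
    and u: "\<And>A. A \<in> sets m \<Longrightarrow> u A = (\<integral>x. indicator A x * h x \<partial>m)"
  shows "pos_variation M u = density m (\<lambda>x. ennreal (h x))"
proof -
  have [measurable]: "h \<in> borel_measurable m" using h by simp
  have int: "integrable m (\<lambda>x. indicator A x * h x)" if "A \<in> sets m" for A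
    using integrable_mult_indicator[OF that h] by simp
  have eq: "pos_sup M u A = (\<integral>\<^sup>+x. ennreal (h x) * indicator A x \<partial>m)" if A [measurable]: "A \<in> sets m" for A
  proof (rule antisym)
    show "pos_sup M u A \<le> (\<integral>\<^sup>+x. ennreal (h x) * indicator A x \<partial>m)"
      unfolding pos_sup_def
    proof (rule SUP_least)
      fix B assume "B \<in> {B \<in> sets M. B \<subseteq> A}"
      then have B [measurable]: "B \<in> sets m" "B \<subseteq> A" using sets by auto
      have int': "integrable m (\<lambda>x. max 0 (indicator B x * h x))"
        using int[OF B(1)] by (intro integrable_max) auto
      have "ennreal (u B) \<le> ennreal (\<integral>x. max 0 (indicator B x * h x) \<partial>m)"
        unfolding u[OF B(1)] by (intro ennreal_leI integral_mono int int' B(1)) auto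
      also have "\<dots> = (\<integral>\<^sup>+x. ennreal (max 0 (indicator B x * h x)) \<partial>m)"
        using int' by (intro nn_integral_eq_integral[symmetric]) auto
      also have "\<dots> \<le> (\<integral>\<^sup>+x. ennreal (h x) * indicator A x \<partial>m)"
        using B(2) by (intro nn_integral_mono) (auto simp: indicator_def max_def ennreal_neg)
      finally show "ennreal (u B) \<le> (\<integral>\<^sup>+x. ennreal (h x) * indicator A x \<partial>m)" .
    qed
    define B where "B = {x \<in> space m. 0 < h x} \<inter> A"
    have B: "B \<in> sets m" unfolding B_def by measurable
    have "(\<integral>\<^sup>+x. ennreal (h x) * indicator A x \<partial>m) = (\<integral>\<^sup>+x. ennreal (indicator B x * h x) \<partial>m)"
      by (intro nn_integral_cong) (auto simp: B_def indicator_def ennreal_neg not_less)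
    also have "\<dots> = ennreal (\<integral>x. indicator B x * h x \<partial>m)"
      by (intro nn_integral_eq_integral int B) (auto simp: B_def indicator_def)
    also have "\<dots> = ennreal (u B)" by (simp add: u[OF B])
    also have "\<dots> \<le> pos_sup M u A"
      using B sets by (intro pos_sup_upper) (auto simp: B_def)
    finally show "(\<integral>\<^sup>+x. ennreal (h x) * indicator A x \<partial>m) \<le> pos_sup M u A" .
  qed
  have "pos_variation M u = measure_of (space m) (sets m) (pos_sup M u)"
    using sets sets_eq_imp_space_eq[OF sets] by (simp add: pos_variation_def pos_sup_def[abs_def])
  also have "\<dots> = measure_of (space m) (sets m) (\<lambda>A. \<integral>\<^sup>+x. ennreal (h x) * indicator A x \<partial>m)"
    by (rule measure_of_eq) (auto simp: sets.space_closed sets.sigma_sets_eq eq)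
  also have "\<dots> = density m (\<lambda>x. ennreal (h x))" by (simp add: density_def)
  finally show ?thesis .
qed

lemma signed_integral_density:
  fixes f :: "'a \<Rightarrow> complex"
  assumes sets: "sets m = sets M" and h: "integrable m h"
    and u: "\<And>A. A \<in> sets m \<Longrightarrow> u A = (\<integral>x. indicator A x * h x \<partial>m)"
    and f [measurable]: "f \<in> borel_measurable m" and fh: "integrable m (\<lambda>x. h x *\<^sub>R f x)"
  shows "signed_integral M u f = (\<integral>x. h x *\<^sub>R f x \<partial>m)"
proof -
  have [measurable]: "h \<in> borel_measurable m" using h by simp
  have part: "integral\<^sup>L (pos_variation M w) f = (\<integral>x. max 0 (g x) *\<^sub>R f x \<partial>m)"
    if g: "integrable m g" and w: "\<And>A. A \<in> sets m \<Longrightarrow> w A = (\<integral>x. indicator A x * g x \<partial>m)" for w g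
  proof -
    have [measurable]: "g \<in> borel_measurable m" using g by simp
    have "pos_variation M w = density m (\<lambda>x. ennreal (g x))"
      by (rule pos_variation_density[OF sets g w])
    also have "\<dots> = density m (\<lambda>x. ennreal (max 0 (g x)))"
      by (intro arg_cong[where f = "density m"] ext) (auto simp: max_def ennreal_neg)
    finally show ?thesis by (simp add: integral_density)
  qed
  have int: "integrable m (\<lambda>x. max 0 (c * h x) *\<^sub>R f x)" if "\<bar>c\<bar> \<le> 1" for c
  proof (rule Bochner_Integration.integrable_bound[OF fh])
    have "max 0 (c * h x) \<le> \<bar>h x\<bar>" for x
      using mult_right_mono[OF that, of "\<bar>h x\<bar>"] by (auto simp: abs_mult[symmetric])
    then show "AE x in m. norm (max 0 (c * h x) *\<^sub>R f x) \<le> norm (h x *\<^sub>R f x)"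
      by (intro AE_I2) (simp add: mult_right_mono)
  qed auto
  have "signed_integral M u f = (\<integral>x. max 0 (h x) *\<^sub>R f x \<partial>m) - (\<integral>x. max 0 (- h x) *\<^sub>R f x \<partial>m)"
    unfolding signed_integral_def using part[OF h u] part[of "\<lambda>x. - h x" "\<lambda>A. - u A"] h u by simp
  also have "\<dots> = (\<integral>x. max 0 (h x) *\<^sub>R f x - max 0 (- h x) *\<^sub>R f x \<partial>m)"
    using int[of 1] int[of "-1"] by simp
  also have "\<dots> = (\<integral>x. h x *\<^sub>R f x \<partial>m)"
    by (intro Bochner_Integration.integral_cong) (auto simp: max_def)
  finally show ?thesis .
qed

text \<open>The positive variation of a measure with real density \<open>h\<close> has density \<open>max 0 h\<close>, whatever the
dominating measure is. This makes the integral against \<open>deformed \<mu> t\<close> computable from a density of \<open>\<mu>\<close>.\<close>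

lemma complex_integral_density:
  assumes sets: "sets m = sets M" and dens: "has_density m \<nu> h"
    and f [measurable]: "f \<in> borel_measurable m" and bnd: "\<And>x. x \<in> space m \<Longrightarrow> norm (f x) \<le> C"
  shows "complex_integral M \<nu> f = (\<integral>x. f x * h x \<partial>m)"
    and "integrable m (\<lambda>x. f x * h x)"
proof -
  have h: "integrable m h" and \<nu>: "\<And>A. A \<in> sets m \<Longrightarrow> \<nu> A = (\<integral>x. indicator A x * h x \<partial>m)"
    using dens by (auto simp: has_density_def)
  have [measurable]: "h \<in> borel_measurable m" using h by simp
  have int: "integrable m (\<lambda>x. g x *\<^sub>R f x)"
    if "g \<in> borel_measurable m" "\<And>x. \<bar>g x\<bar> \<le> norm (h x)" for g :: "'a \<Rightarrow> real"
  proof (rule Bochner_Integration.integrable_bound)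
    show "integrable m (\<lambda>x. C * norm (h x))" using h by auto
    show "AE x in m. norm (g x *\<^sub>R f x) \<le> norm (C * norm (h x))"
    proof (rule AE_I2)
      fix x assume "x \<in> space m"
      then have "norm (f x) * \<bar>g x\<bar> \<le> C * norm (h x)"
        using bnd[of x] that(2)[of x] by (intro mult_mono) (auto intro: order_trans[OF norm_ge_zero])
      then show "norm (g x *\<^sub>R f x) \<le> norm (C * norm (h x))"
        by (simp add: mult.commute)
    qed
  qed (use that in auto)
  have ih: "integrable m (\<lambda>x. indicator A x * h x)" if "A \<in> sets m" for A
    by (rule integrable_indicator_times[OF that h])
  have intRe: "integrable m (\<lambda>x. Re (h x) *\<^sub>R f x)" and intIm: "integrable m (\<lambda>x. Im (h x) *\<^sub>R f x)"
    by (intro int; simp add: abs_Re_le_cmod abs_Im_le_cmod)+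
  have re: "Re (\<nu> A) = (\<integral>x. indicator A x * Re (h x) \<partial>m)"
    and im: "Im (\<nu> A) = (\<integral>x. indicator A x * Im (h x) \<partial>m)" if A: "A \<in> sets m" for A
    unfolding \<nu>[OF A] integral_Re[OF ih[OF A], symmetric] integral_Im[OF ih[OF A], symmetric]
    by (intro Bochner_Integration.integral_cong; auto simp: indicator_def)+
  have eq: "Re (h x) *\<^sub>R f x + \<i> * (Im (h x) *\<^sub>R f x) = f x * h x" for x
    by (simp add: complex_eq_iff algebra_simps)
  have "complex_integral M \<nu> f = (\<integral>x. Re (h x) *\<^sub>R f x \<partial>m) + \<i> * (\<integral>x. Im (h x) *\<^sub>R f x \<partial>m)"
    unfolding complex_integral_def
    using signed_integral_density[OF sets _ re f intRe] signed_integral_density[OF sets _ im f intIm] h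
    by simp
  also have "\<dots> = (\<integral>x. Re (h x) *\<^sub>R f x + \<i> * (Im (h x) *\<^sub>R f x) \<partial>m)"
    using intRe integrable_mult_right[of \<i>, OF intIm] by (simp del: mult_scaleR_right)
  finally show "complex_integral M \<nu> f = (\<integral>x. f x * h x \<partial>m)" by (simp only: eq)
  show "integrable m (\<lambda>x. f x * h x)"
    using Bochner_Integration.integrable_add[OF intRe integrable_mult_right[of \<i>, OF intIm]]
    by (simp only: eq)
qed

section \<open>Moments of the deformed measure\<close>

definition moment :: "(complex set \<Rightarrow> complex) \<Rightarrow> int \<Rightarrow> complex" where
  "moment \<nu> n = circle_integral \<nu> (\<lambda>z. z powi n)"

definition weight :: "(nat \<Rightarrow> nat \<Rightarrow> complex) \<Rightarrow> complex \<Rightarrow> complex" where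
  "weight t z = exp (\<Sum>j. t 1 (Suc j) * z ^ Suc j - t 2 (Suc j) * inverse z ^ Suc j)"

lemma space_circle: "sets m = sets circle \<Longrightarrow> space m = sphere 0 1"
  by (drule sets_eq_imp_space_eq) (simp add: space_restrict_space)

lemma borel_measurable_circle:
  assumes "sets m = sets circle" "f \<in> borel_measurable borel"
  shows "f \<in> borel_measurable m"
  using measurable_restrict_space1[OF assms(2), of "sphere 0 1"] measurable_cong_sets[OF assms(1) refl]
  by blast

lemma borel_measurable_powi [measurable]: "(\<lambda>z::complex. z powi n) \<in> borel_measurable borel"
  unfolding power_int_def by measurable

lemma borel_measurable_weight: "weight t \<in> borel_measurable borel"
  unfolding weight_def by measurable

text \<open>Every integral in the definitions of the orthogonal polynomials and of the moment matrices has an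
integrand that agrees on the circle with a Laurent polynomial, so it depends on the moments alone.\<close>

lemma circle_integral_laurent:
  assumes sets: "sets m = sets circle" and dens: "has_density m \<nu> h" and I: "finite I"
    and f: "\<And>z. norm z = 1 \<Longrightarrow> f z = (\<Sum>i\<in>I. a i * z powi k i)"
  shows "circle_integral \<nu> f = (\<Sum>i\<in>I. a i * moment \<nu> (k i))"
proof -
  have sp: "space m = sphere 0 1" by (rule space_circle[OF sets])
  have eq: "f z = (\<Sum>i\<in>I. a i * z powi k i)" if "z \<in> space m" for z
    using f that by (simp add: sp)
  have "(\<lambda>z. \<Sum>i\<in>I. a i * z powi k i) \<in> borel_measurable m"
    by (intro borel_measurable_circle[OF sets]) measurable
  then have meas: "f \<in> borel_measurable m"
    using measurable_cong[of m f "\<lambda>z. \<Sum>i\<in>I. a i * z powi k i" borel] eq by blast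
  have bnd: "norm (f z) \<le> (\<Sum>i\<in>I. norm (a i))" if "z \<in> space m" for z
    unfolding eq[OF that] using that
    by (intro order_trans[OF norm_sum] sum_mono) (simp add: sp norm_mult norm_power_int)
  have pw: "(\<lambda>z. z powi n) \<in> borel_measurable m" for n
    by (intro borel_measurable_circle[OF sets]) measurable
  have pb: "norm (z powi n) \<le> 1" if "z \<in> space m" for z n
    using that by (simp add: sp norm_power_int)
  have mom: "moment \<nu> n = (\<integral>z. z powi n * h z \<partial>m)" for n
    unfolding moment_def by (rule complex_integral_density(1)[OF sets dens pw pb])
  have int: "integrable m (\<lambda>z. z powi n * h z)" for n
    by (rule complex_integral_density(2)[OF sets dens pw pb])
  have "circle_integral \<nu> f = (\<integral>z. f z * h z \<partial>m)"
    by (rule complex_integral_density(1)[OF sets dens meas bnd])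
  also have "\<dots> = (\<integral>z. (\<Sum>i\<in>I. a i * (z powi k i * h z)) \<partial>m)"
    by (intro Bochner_Integration.integral_cong refl) (simp add: eq sum_distrib_right mult.assoc)
  also have "\<dots> = (\<Sum>i\<in>I. a i * (\<integral>z. z powi k i * h z \<partial>m))"
    using int by (simp add: Bochner_Integration.integral_sum)
  finally show ?thesis by (simp add: mom)
qed

text \<open>Convergence at \<open>z = 2\<close> gives absolute convergence at \<open>z = 1\<close>.\<close>

lemma admissible_summable_norm:
  assumes "admissible t" "a \<in> {1, 2}"
  shows "summable (\<lambda>j. norm (t a (Suc j)))"
proof -
  let ?f = "\<lambda>n. if n = 0 then 0 else t a n"
  have "summable (\<lambda>j. t a (Suc j) * 2 ^ Suc j)"
    using assms by (auto simp: admissible_def)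
  then have "summable (\<lambda>n. ?f n * 2 ^ n)"
    by (subst summable_Suc_iff[symmetric]) simp
  then have "summable (\<lambda>n. norm (?f n * 1 ^ n))"
    by (rule powser_insidea) simp
  then show ?thesis
    by (subst (asm) summable_Suc_iff[symmetric]) simp
qed

lemma admissible_summable_circle:
  assumes t: "admissible t" and z: "norm z = 1"
  shows "summable (\<lambda>j. norm (t 1 (Suc j) * z ^ Suc j - t 2 (Suc j) * inverse z ^ Suc j))"
    and "(\<Sum>j. norm (t 1 (Suc j) * z ^ Suc j - t 2 (Suc j) * inverse z ^ Suc j)) \<le>
      (\<Sum>j. norm (t 1 (Suc j)) + norm (t 2 (Suc j)))"
proof -
  have le: "norm (t 1 (Suc j) * z ^ Suc j - t 2 (Suc j) * inverse z ^ Suc j) \<le>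
      norm (t 1 (Suc j)) + norm (t 2 (Suc j))" for j
    using norm_triangle_ineq4[of "t 1 (Suc j) * z ^ Suc j" "t 2 (Suc j) * inverse z ^ Suc j"] z
    by (simp add: norm_mult norm_power norm_inverse del: power_Suc)
  have sum: "summable (\<lambda>j. norm (t 1 (Suc j)) + norm (t 2 (Suc j)))"
    using admissible_summable_norm[OF t] by (intro summable_add) auto
  show *: "summable (\<lambda>j. norm (t 1 (Suc j) * z ^ Suc j - t 2 (Suc j) * inverse z ^ Suc j))"
    by (rule summable_comparison_test[OF _ sum]) (use le in auto)
  show "(\<Sum>j. norm (t 1 (Suc j) * z ^ Suc j - t 2 (Suc j) * inverse z ^ Suc j)) \<le>
      (\<Sum>j. norm (t 1 (Suc j)) + norm (t 2 (Suc j)))"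
    by (rule suminf_le[OF le * sum])
qed

lemma weight_bounded:
  assumes t: "admissible t"
  shows "\<exists>C. \<forall>z. norm z = 1 \<longrightarrow> norm (weight t z) \<le> C"
proof (intro exI allI impI)
  fix z :: complex assume z: "norm z = 1"
  let ?S = "\<Sum>j. t 1 (Suc j) * z ^ Suc j - t 2 (Suc j) * inverse z ^ Suc j"
  have "Re ?S \<le> norm ?S" by (rule complex_Re_le_cmod)
  also have "\<dots> \<le> (\<Sum>j. norm (t 1 (Suc j) * z ^ Suc j - t 2 (Suc j) * inverse z ^ Suc j))"
    by (rule summable_norm[OF admissible_summable_circle(1)[OF t z]])
  also note admissible_summable_circle(2)[OF t z]
  finally show "norm (weight t z) \<le> exp (\<Sum>j. norm (t 1 (Suc j)) + norm (t 2 (Suc j)))"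
    by (simp add: weight_def)
qed

lemma deformed_has_density:
  assumes sets: "sets m = sets circle" and dens: "has_density m \<mu> h" and t: "admissible t"
  shows "has_density m (deformed \<mu> t) (\<lambda>z. weight t z * h z)"
proof -
  obtain C where C: "\<And>z. norm z = 1 \<Longrightarrow> norm (weight t z) \<le> C"
    using weight_bounded[OF t] by blast
  have sp: "space m = sphere 0 1" by (rule space_circle[OF sets])
  have wm [measurable]: "weight t \<in> borel_measurable m"
    by (rule borel_measurable_circle[OF sets borel_measurable_weight])
  have "integrable m (\<lambda>z. weight t z * h z)"
    by (rule complex_integral_density(2)[OF sets dens wm, of C]) (use C sp in auto)
  moreover have "deformed \<mu> t A = (\<integral>z. indicator A z * (weight t z * h z) \<partial>m)"
    if A [measurable]: "A \<in> sets m" for A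
  proof -
    have "deformed \<mu> t A = circle_integral \<mu> (\<lambda>z. indicator A z * weight t z)"
      by (simp add: deformed_def weight_def)
    also have "\<dots> = (\<integral>z. (indicator A z * weight t z) * h z \<partial>m)"
    proof (rule complex_integral_density(1)[OF sets dens])
      show "norm (indicator A z * weight t z) \<le> C" if "z \<in> space m" for z
        using C[of z] that sp norm_ge_zero[of "weight t z"]
        by (auto simp: indicator_def simp del: norm_ge_zero)
    qed measurable
    finally show ?thesis by (simp add: mult.assoc)
  qed
  ultimately show ?thesis by (simp add: has_density_def)
qed

lemma set_param_same [simp]: "set_param t b j (t b j) = t"
  by (simp add: set_param_def)

lemma admissible_set_param:
  assumes "admissible t"
  shows "admissible (set_param t b j s)"
  unfolding admissible_def
proof (intro ballI allI)
  fix a z assume a: "a \<in> {1, 2::nat}"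
  have "summable (\<lambda>i. t a (Suc i) * z ^ Suc i)" using assms a by (auto simp: admissible_def)
  moreover have "\<forall>\<^sub>F i in sequentially.
      set_param t b j s a (Suc i) * z ^ Suc i = t a (Suc i) * z ^ Suc i"
    unfolding eventually_sequentially by (intro exI[of _ j]) (auto simp: set_param_def)
  ultimately show "summable (\<lambda>i. set_param t b j s a (Suc i) * z ^ Suc i)"
    using summable_cong by force
qed

text \<open>The sign with which the parameter \<open>t\<^sub>b\<^sub>j\<close> and the power \<open>z\<^sup>\<plusminus>\<^sup>j\<close> enter the weight.\<close>

definition flow_sign :: "nat \<Rightarrow> int" where
  "flow_sign b = (if b = 1 then 1 else - 1)"

lemma weight_set_param:
  assumes t: "admissible t" and b: "b \<in> {1, 2}" and j: "1 \<le> j" and z: "norm z = 1"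
  shows "weight (set_param t b j s) z =
    exp ((s - t b j) * (of_int (flow_sign b) * z powi (flow_sign b * int j))) * weight t z"
proof -
  let ?a = "\<lambda>t i. t 1 (Suc i) * z ^ Suc i - t 2 (Suc i) * inverse z ^ Suc i"
  let ?d = "(s - t b j) * (of_int (flow_sign b) * z powi (flow_sign b * int j))"
  have "summable (?a t)"
    using admissible_summable_circle(1)[OF t z] by (rule summable_norm_cancel)
  then have "?a t sums (\<Sum>i. ?a t i)" by (rule summable_sums)
  moreover have "(\<lambda>i. if i = j - 1 then ?d else 0) sums ?d"
    using sums_single[of "j - 1" "\<lambda>_. ?d"] by simp
  ultimately have "(\<lambda>i. ?a t i + (if i = j - 1 then ?d else 0)) sums ((\<Sum>i. ?a t i) + ?d)"
    by (rule sums_add)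
  moreover have "?a (set_param t b j s) i = ?a t i + (if i = j - 1 then ?d else 0)" for i
  proof (cases "i = j - 1")
    case True
    then have "Suc i = j" using j by simp
    then show ?thesis using b True
      by (auto simp: set_param_def flow_sign_def algebra_simps power_int_minus power_inverse
          simp del: power_Suc)
  next
    case False
    then have "Suc i \<noteq> j" by auto
    then show ?thesis using False by (simp add: set_param_def)
  qed
  ultimately have "?a (set_param t b j s) sums ((\<Sum>i. ?a t i) + ?d)" by (simp only:)
  then have "(\<Sum>i. ?a (set_param t b j s) i) = (\<Sum>i. ?a t i) + ?d" by (rule sums_unique[symmetric])
  then show ?thesis by (simp add: weight_def exp_add mult.commute)
qed

lemma exp_remainder:
  fixes d v :: complex
  assumes "norm v = 1" "norm d \<le> 1"
  shows "norm (exp (d * v) - 1 - d * v) \<le> exp 1 * norm d ^ 2"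
proof -
  have "norm (exp (d * v) - (\<Sum>k\<le>1. (d * v) ^ k / fact k)) \<le>
      exp \<bar>Re (d * v)\<bar> * norm (d * v) ^ Suc 1 / fact 1"
    by (rule Taylor_exp)
  also have "\<dots> \<le> exp 1 * norm d ^ 2"
    using assms abs_Re_le_cmod[of "d * v"]
    by (auto simp: norm_mult power2_eq_square intro!: mult_right_mono)
  finally show ?thesis by (simp add: diff_diff_eq)
qed

text \<open>By \<open>weight_set_param\<close> the integrand at the parameter \<open>s\<close> is the one at \<open>t b j\<close> times
\<open>exp ((s - t b j) v)\<close> with \<open>\<bar>v\<bar> = 1\<close> on the circle. The first-order Taylor remainder is bounded by a
constant times \<open>\<bar>s - t b j\<bar>\<^sup>2\<close> uniformly on the circle, which permits to differentiate under the
integral sign.\<close>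

lemma has_field_derivative_moment:
  assumes sets: "sets m = sets circle" and dens: "has_density m \<mu> h" and t: "admissible t"
    and b: "b \<in> {1, 2}" and j: "1 \<le> j"
  shows "((\<lambda>s. moment (deformed \<mu> (set_param t b j s)) n) has_field_derivative
    of_int (flow_sign b) * moment (deformed \<mu> t) (n + flow_sign b * int j)) (at (t b j))"
proof -
  define s0 where "s0 = t b j"
  define v where "v z = of_int (flow_sign b) * z powi (flow_sign b * int j)" for z :: complex
  define H where "H z = weight t z * h z" for z
  have sp: "space m = sphere 0 1" by (rule space_circle[OF sets])
  have pw: "(\<lambda>z. z powi n) \<in> borel_measurable m" for n
    by (intro borel_measurable_circle[OF sets]) measurable
  have pb: "norm (z powi n) \<le> 1" if "z \<in> space m" for z n
    using that by (simp add: sp norm_power_int)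
  have v1: "norm (v z) = 1" if "z \<in> space m" for z
    using that by (simp add: v_def sp norm_mult norm_power_int flow_sign_def)
  have mom: "moment (deformed \<mu> r) n = (\<integral>z. z powi n * (weight r z * h z) \<partial>m)"
    and int: "integrable m (\<lambda>z. z powi n * (weight r z * h z))" if "admissible r" for n r
    unfolding moment_def
    by (rule complex_integral_density(1)[OF sets deformed_has_density[OF sets dens that] pw pb])
      (assumption, rule complex_integral_density(2)[OF sets deformed_has_density[OF sets dens that] pw pb])
  note adm = admissible_set_param[OF t, of b j]
  have weight: "weight (set_param t b j s) z = exp ((s - s0) * v z) * weight t z" if "z \<in> space m" for s z
    unfolding s0_def v_def using that by (intro weight_set_param[OF t b j]) (simp add: sp)
  define F where "F s = moment (deformed \<mu> (set_param t b j s)) n" for s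
  define F' where "F' = of_int (flow_sign b) * moment (deformed \<mu> t) (n + flow_sign b * int j)"
  define K where "K = (\<integral>z. norm (z powi n * H z) \<partial>m)"
  have F': "F' = (\<integral>z. v z * (z powi n * H z) \<partial>m)"
    and iF': "integrable m (\<lambda>z. v z * (z powi n * H z))"
  proof -
    have eq: "of_int (flow_sign b) * (z powi (n + flow_sign b * int j) * (weight t z * h z)) =
        v z * (z powi n * H z)" if "z \<in> space m" for z
    proof -
      have "z \<noteq> 0" using that by (auto simp: sp)
      then show ?thesis by (simp add: v_def H_def power_int_add mult_ac)
    qed
    have "F' = (\<integral>z. of_int (flow_sign b) * (z powi (n + flow_sign b * int j) * (weight t z * h z)) \<partial>m)"
      unfolding F'_def mom[OF t] by simp
    also have "\<dots> = (\<integral>z. v z * (z powi n * H z) \<partial>m)"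
      by (intro Bochner_Integration.integral_cong refl eq)
    finally show "F' = (\<integral>z. v z * (z powi n * H z) \<partial>m)" .
    have "integrable m (\<lambda>z. of_int (flow_sign b) * (z powi (n + flow_sign b * int j) * (weight t z * h z)))"
      by (intro integrable_mult_right int[OF t])
    moreover have "integrable m (\<lambda>z. of_int (flow_sign b) * (z powi (n + flow_sign b * int j) * (weight t z * h z))) \<longleftrightarrow>
        integrable m (\<lambda>z. v z * (z powi n * H z))"
      by (intro Bochner_Integration.integrable_cong refl eq)
    ultimately show "integrable m (\<lambda>z. v z * (z powi n * H z))" by blast
  qed
  have iH: "integrable m (\<lambda>z. z powi n * H z)" unfolding H_def by (rule int[OF t])
  have iF: "integrable m (\<lambda>z. exp ((s - s0) * v z) * (z powi n * H z))"
    and F: "F s = (\<integral>z. exp ((s - s0) * v z) * (z powi n * H z) \<partial>m)" for s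
  proof -
    have eq: "z powi n * (weight (set_param t b j s) z * h z) = exp ((s - s0) * v z) * (z powi n * H z)"
      if "z \<in> space m" for z
      by (simp add: weight[OF that] H_def mult_ac)
    have "integrable m (\<lambda>z. z powi n * (weight (set_param t b j s) z * h z)) \<longleftrightarrow>
        integrable m (\<lambda>z. exp ((s - s0) * v z) * (z powi n * H z))"
      by (intro Bochner_Integration.integrable_cong refl eq)
    then show "integrable m (\<lambda>z. exp ((s - s0) * v z) * (z powi n * H z))"
      using int[OF adm] by blast
    show "F s = (\<integral>z. exp ((s - s0) * v z) * (z powi n * H z) \<partial>m)"
      unfolding F_def mom[OF adm] by (intro Bochner_Integration.integral_cong refl eq)
  qed
  have bound: "norm ((F (s0 + d) - F s0) / d - F') \<le> exp 1 * K * norm d"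
    if d: "d \<noteq> 0" "norm d \<le> 1" for d
  proof -
    let ?R = "\<lambda>z. exp (d * v z) - 1 - d * v z"
    define G where "G z = z powi n * H z" for z
    have eqR: "?R z * G z = exp (d * v z) * G z - G z - d * (v z * G z)" for z
      by (simp add: algebra_simps)
    have iG: "integrable m (\<lambda>z. exp (d * v z) * G z)" "integrable m G" "integrable m (\<lambda>z. d * (v z * G z))"
      using iF[of "s0 + d"] iH iF' unfolding G_def by simp_all
    have iR: "integrable m (\<lambda>z. ?R z * G z)"
      unfolding eqR by (intro Bochner_Integration.integrable_diff iG)
    have "F (s0 + d) - F s0 - d * F' = (\<integral>z. ?R z * G z \<partial>m)"
      unfolding eqR using iG unfolding F F' G_def[symmetric] by simp
    also have "norm \<dots> \<le> (\<integral>z. exp 1 * norm d ^ 2 * norm (G z) \<partial>m)"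
    proof (rule Bochner_Integration.integral_norm_bound_integral[OF iR])
      show "norm (?R z * (G z)) \<le> exp 1 * norm d ^ 2 * norm (G z)"
        if "z \<in> space m" for z
        unfolding norm_mult[of "?R z"] using exp_remainder[OF v1[OF that] d(2)]
        by (intro mult_right_mono) auto
    qed (use iG in auto)
    also have "\<dots> = exp 1 * norm d ^ 2 * K" by (simp add: K_def G_def)
    finally have "norm (F (s0 + d) - F s0 - d * F') \<le> exp 1 * norm d ^ 2 * K" .
    moreover have "(F (s0 + d) - F s0) / d - F' = (F (s0 + d) - F s0 - d * F') / d"
      using d(1) by (simp add: field_simps)
    ultimately show ?thesis
      using d(1) by (simp add: norm_divide power2_eq_square divide_le_eq mult_ac)
  qed
  have "((\<lambda>d. (F (s0 + d) - F s0) / d - F') \<longlongrightarrow> 0) (at 0)"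
  proof (rule Lim_null_comparison)
    show "\<forall>\<^sub>F d in at 0. norm ((F (s0 + d) - F s0) / d - F') \<le> exp 1 * K * norm d"
      unfolding eventually_at using bound by (intro exI[of _ 1]) (auto simp: dist_norm)
    show "((\<lambda>d. exp 1 * K * norm d) \<longlongrightarrow> 0) (at (0::complex))"
      by (intro tendsto_mult_right_zero tendsto_norm_zero tendsto_ident_at)
  qed
  then have "(F has_field_derivative F') (at s0)"
    unfolding DERIV_def by (rule LIM_zero_cancel)
  then show ?thesis by (simp add: F_def[abs_def] F'_def s0_def)
qed

section \<open>Gaussian elimination\<close>

text \<open>\<open>elim k g\<close> is the matrix after the first \<open>k\<close> steps of Gaussian elimination, and row \<open>i\<close> of
\<open>elim_ops k g\<close> contains the coefficients of the row operations that lead to row \<open>i\<close> of \<open>elim k g\<close>. Row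
\<open>i\<close> is final after \<open>i\<close> steps. This form of the factorization involves only finitely many arithmetic
operations for each entry, so differentiability of the factors is immediate.\<close>

fun elim :: "nat \<Rightarrow> imat \<Rightarrow> imat" where
  "elim 0 g = g"
| "elim (Suc k) g = (\<lambda>i j. elim k g i j - elim k g i k / elim k g k k * elim k g k j)"

fun elim_ops :: "nat \<Rightarrow> imat \<Rightarrow> imat" where
  "elim_ops 0 g = imat_one"
| "elim_ops (Suc k) g =
    (\<lambda>i j. elim_ops k g i j - elim k g i k / elim k g k k * elim_ops k g k j)"

definition lower_factor :: "imat \<Rightarrow> imat" where
  "lower_factor g i j = elim_ops i g i j"

definition upper_factor :: "imat \<Rightarrow> imat" where
  "upper_factor g i j = elim i g i j"

definition pivots_nonzero :: "imat \<Rightarrow> nat \<Rightarrow> bool" where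
  "pivots_nonzero g n \<longleftrightarrow> (\<forall>k<n. upper_factor g k k \<noteq> 0)"

text \<open>Non-singularity is expressed by left null vectors because elimination by rows and the comparison of
two factorizations produce such vectors.\<close>

definition block_nonsingular :: "imat \<Rightarrow> nat \<Rightarrow> bool" where
  "block_nonsingular g n \<longleftrightarrow>
    (\<forall>x. (\<forall>j<n. (\<Sum>i<n. x i * g i j) = 0) \<longrightarrow> (\<forall>i<n. x i = 0))"

lemma elim_ops_unit: "k \<le> j \<Longrightarrow> elim_ops k g i j = imat_one i j"
  by (induction k arbitrary: i) (auto simp: imat_one_def)

lemma elim_ops_mult:
  "k \<le> i \<Longrightarrow> i \<le> n \<Longrightarrow> elim k g i j = (\<Sum>m\<le>n. elim_ops k g i m * g m j)"
proof (induction k arbitrary: i)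
  case 0
  then show ?case by (simp add: imat_one_def if_distrib[of "\<lambda>x. x * _"] cong: if_cong)
next
  case (Suc k)
  have "elim k g i j = (\<Sum>m\<le>n. elim_ops k g i m * g m j)"
    and "elim k g k j = (\<Sum>m\<le>n. elim_ops k g k m * g m j)"
    using Suc by (auto intro!: Suc.IH)
  then show ?case
    by (simp add: left_diff_distrib sum_subtractf sum_distrib_left sum_divide_distrib mult.assoc)
qed

lemma elim_eq_0:
  assumes "pivots_nonzero g k" "k \<le> i" "j < k"
  shows "elim k g i j = 0"
  using assms
proof (induction k arbitrary: i)
  case (Suc k)
  have piv: "elim k g k k \<noteq> 0"
    using Suc.prems by (auto simp: pivots_nonzero_def upper_factor_def)
  have "pivots_nonzero g k" using Suc.prems(1) by (simp add: pivots_nonzero_def)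
  then have "elim k g i j = 0 \<and> elim k g k j = 0" if "j < k"
    using Suc.IH that Suc.prems by auto
  then show ?case using piv Suc.prems(3) by (cases "j = k") auto
qed simp

lemma lower_unitriangular_lower_factor: "lower_unitriangular (lower_factor g)"
  by (simp add: lower_unitriangular_def lower_factor_def elim_ops_unit imat_one_def)

lemma factor_mult: "i \<le> n \<Longrightarrow> upper_factor g i j = (\<Sum>m\<le>n. lower_factor g i m * g m j)"
  unfolding upper_factor_def lower_factor_def by (rule elim_ops_mult) auto

lemma upper_factor_eq_0: "pivots_nonzero g i \<Longrightarrow> j < i \<Longrightarrow> upper_factor g i j = 0"
  unfolding upper_factor_def by (rule elim_eq_0) auto

text \<open>A vanishing pivot would make the last row of the lower factor a left null vector of the block.\<close>

lemma pivot_nonzero_step: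
  assumes "pivots_nonzero g n" "block_nonsingular g (Suc n)"
  shows "upper_factor g n n \<noteq> 0"
proof
  assume 0: "upper_factor g n n = 0"
  have "(\<Sum>i<Suc n. lower_factor g n i * g i j) = 0" if "j < Suc n" for j
    using 0 upper_factor_eq_0[OF assms(1), of j] that factor_mult[of n n g j]
    by (cases "j = n") (auto simp: lessThan_Suc_atMost)
  then have "lower_factor g n n = 0"
    using assms(2) unfolding block_nonsingular_def by blast
  then show False
    using lower_unitriangular_lower_factor[of g] by (simp add: lower_unitriangular_def)
qed

lemma pivots_nonzero_if_nonsingular:
  assumes "\<And>m. m \<le> n \<Longrightarrow> block_nonsingular g m"
  shows "pivots_nonzero g n"
  using assms
proof (induction n)
  case (Suc n)
  then have "pivots_nonzero g n" "upper_factor g n n \<noteq> 0"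
    using pivot_nonzero_step by auto
  then show ?case by (auto simp: pivots_nonzero_def less_Suc_eq)
qed (simp add: pivots_nonzero_def)

text \<open>The converse of \<open>pivots_nonzero_if_nonsingular\<close>. It is needed because the condition on the pivots,
for a fixed number of them, is stable under small changes of the parameter.\<close>

lemma nonsingular_if_pivots_nonzero:
  "pivots_nonzero g n \<Longrightarrow> block_nonsingular g n"
proof (induction n)
  case (Suc n)
  have piv: "pivots_nonzero g n" and pn: "upper_factor g n n \<noteq> 0"
    using Suc.prems by (auto simp: pivots_nonzero_def)
  have unit: "lower_factor g n n = 1"
    using lower_unitriangular_lower_factor[of g] by (simp add: lower_unitriangular_def)
  show ?case
    unfolding block_nonsingular_def
  proof (intro allI impI)
    fix x :: "nat \<Rightarrow> complex" and i
    assume x: "\<forall>j<Suc n. (\<Sum>i<Suc n. x i * g i j) = 0" and i: "i < Suc n"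
    \<comment> \<open>Subtracting a multiple of the last row of the lower factor leaves a combination of the
      first \<open>n\<close> rows.\<close>
    define y where "y i = x i - x n * lower_factor g n i" for i
    have y: "(\<Sum>i<Suc n. x i * g i j) = (\<Sum>i<n. y i * g i j) + x n * upper_factor g n j" for j
      unfolding factor_mult[OF order_refl] lessThan_Suc_atMost[symmetric]
      by (simp add: y_def unit left_diff_distrib sum_subtractf sum_distrib_left mult.assoc
          algebra_simps)
    have "\<forall>j<n. (\<Sum>i<n. y i * g i j) = 0"
    proof (intro allI impI)
      fix j assume j: "j < n"
      show "(\<Sum>i<n. y i * g i j) = 0"
        using y[of j] x j upper_factor_eq_0[OF piv j] by simp
    qed
    then have y0: "\<forall>i<n. y i = 0"
      using Suc.IH[OF piv] by (simp add: block_nonsingular_def)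
    then have "x n * upper_factor g n n = 0" using y[of n] x by simp
    then have "x n = 0" using pn by simp
    then show "x i = 0" using y0 i by (auto simp: y_def less_Suc_eq)
  qed
qed (simp add: block_nonsingular_def)

lemma field_differentiable_elim:
  assumes G: "\<And>i j. (\<lambda>s. G s i j) field_differentiable (at x within R)"
    and "pivots_nonzero (G x) k"
  shows "(\<lambda>s. elim k (G s) i j) field_differentiable (at x within R)"
    and "(\<lambda>s. elim_ops k (G s) i j) field_differentiable (at x within R)"
proof -
  have "(\<lambda>s. elim k (G s) i j) field_differentiable (at x within R) \<and>
    (\<lambda>s. elim_ops k (G s) i j) field_differentiable (at x within R)"
    using assms(2)
  proof (induction k arbitrary: i j)
    case (Suc k)
    have "pivots_nonzero (G x) k" "elim k (G x) k k \<noteq> 0"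
      using Suc.prems by (auto simp: pivots_nonzero_def upper_factor_def)
    with Suc.IH show ?case
      by (auto intro!: field_differentiable_diff field_differentiable_mult field_differentiable_divide)
  qed (use G in auto)
  then show "(\<lambda>s. elim k (G s) i j) field_differentiable (at x within R)"
    "(\<lambda>s. elim_ops k (G s) i j) field_differentiable (at x within R)" by auto
qed

section \<open>Semi-infinite matrices\<close>

lemma imat_mult_eq_sum:
  assumes "finite K" "\<And>k. k \<notin> K \<Longrightarrow> A i k * B k j = 0"
  shows "(A \<odot> B) i j = (\<Sum>k\<in>K. A i k * B k j)"
  unfolding imat_mult_def using assms by (rule suminf_finite)

lemma imat_transpose_transpose [simp]: "imat_transpose (imat_transpose A) = A"
  by (simp add: imat_transpose_def fun_eq_iff)

lemma imat_transpose_mult: "imat_transpose (A \<odot> B) = imat_transpose B \<odot> imat_transpose A"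
  by (simp add: imat_transpose_def imat_mult_def fun_eq_iff mult.commute)

lemma imat_transpose_one [simp]: "imat_transpose imat_one = imat_one"
  by (auto simp: imat_transpose_def imat_one_def fun_eq_iff)

lemma imat_one_mult [simp]: "imat_one \<odot> A = A"
proof (intro ext)
  fix i j
  have "(imat_one \<odot> A) i j = (\<Sum>k\<in>{i}. imat_one i k * A k j)"
    by (rule imat_mult_eq_sum) (auto simp: imat_one_def)
  then show "(imat_one \<odot> A) i j = A i j" by (simp add: imat_one_def)
qed

lemma imat_mult_one [simp]: "A \<odot> imat_one = A"
  by (metis imat_one_mult imat_transpose_mult imat_transpose_one imat_transpose_transpose)

text \<open>Products of semi-infinite matrices are not associative in general. For one entry it suffices that the
double sum has finitely many non-zero terms, which covers two Hessenberg factors on the left as well as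
an arbitrary matrix between a row-finite and a column-finite one.\<close>

lemma imat_mult_assoc_entry:
  assumes K: "finite K" "\<And>k. k \<notin> K \<Longrightarrow> A i k = 0"
    and M: "finite M" "\<And>k m. k \<in> K \<Longrightarrow> m \<notin> M \<Longrightarrow> B k m * C m j = 0"
  shows "((A \<odot> B) \<odot> C) i j = (A \<odot> (B \<odot> C)) i j"
proof -
  have AB: "(A \<odot> B) i m = (\<Sum>k\<in>K. A i k * B k m)" for m
    by (rule imat_mult_eq_sum) (use K in auto)
  have BC: "(B \<odot> C) k j = (\<Sum>m\<in>M. B k m * C m j)" if "k \<in> K" for k
    by (rule imat_mult_eq_sum) (use M that in auto)
  have "((A \<odot> B) \<odot> C) i j = (\<Sum>m\<in>M. (A \<odot> B) i m * C m j)"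
    by (rule imat_mult_eq_sum)
      (use M in \<open>auto simp: AB sum_distrib_right mult.assoc simp del: mult_eq_0_iff intro!: sum.neutral\<close>)
  also have "\<dots> = (\<Sum>k\<in>K. \<Sum>m\<in>M. A i k * (B k m * C m j))"
    unfolding AB sum_distrib_right mult.assoc by (rule sum.swap)
  also have "\<dots> = (\<Sum>k\<in>K. A i k * (B \<odot> C) k j)"
    by (intro sum.cong refl) (simp add: BC sum_distrib_left)
  also have "\<dots> = (A \<odot> (B \<odot> C)) i j"
    by (rule imat_mult_eq_sum[symmetric]) (use K in auto)
  finally show ?thesis .
qed

text \<open>Lower Hessenberg matrices with \<open>d\<close> superdiagonals. A left factor of this kind has rows of a length
that does not depend on the matrix, so products are finite sums, associativity holds, and the product
rule holds for families of matrices. Columns are treated by transposition.\<close>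

definition hess :: "nat \<Rightarrow> imat \<Rightarrow> bool" where
  "hess d A \<longleftrightarrow> (\<forall>i j. i + d < j \<longrightarrow> A i j = 0)"

lemma hessD: "hess d A \<Longrightarrow> i + d < j \<Longrightarrow> A i j = 0"
  by (simp add: hess_def)

lemma hess_mono: "hess d A \<Longrightarrow> d \<le> e \<Longrightarrow> hess e A"
  by (simp add: hess_def)

lemma hess_mult_eq_sum:
  assumes "hess d A" "i + d \<le> n"
  shows "(A \<odot> B) i j = (\<Sum>k\<le>n. A i k * B k j)"
  by (rule imat_mult_eq_sum) (use assms in \<open>auto simp: hess_def\<close>)

lemma hess_one [simp]: "hess d imat_one"
  by (simp add: hess_def imat_one_def)

lemma hess_mult:
  assumes "hess d A" "hess e B"
  shows "hess (d + e) (A \<odot> B)"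
  unfolding hess_def
proof (intro allI impI)
  fix i j assume "i + (d + e) < j"
  then have "A i k * B k j = 0" if "k \<le> i + d" for k
    using hessD[OF assms(2), of k j] that by simp
  then show "(A \<odot> B) i j = 0"
    unfolding hess_mult_eq_sum[OF assms(1) order_refl] by (intro sum.neutral) auto
qed

lemma hess_pow: "hess d A \<Longrightarrow> hess (n * d) (imat_pow A n)"
proof (induction n)
  case (Suc n)
  then show ?case using hess_mult[of d A "n * d" "imat_pow A n"] by simp
qed simp

lemma imat_mult_assoc_hess:
  assumes "hess d A" "hess e B"
  shows "(A \<odot> B) \<odot> C = A \<odot> (B \<odot> C)"
proof (intro ext)
  fix i j
  show "((A \<odot> B) \<odot> C) i j = (A \<odot> (B \<odot> C)) i j"
    by (rule imat_mult_assoc_entry[where K = "{..i + d}" and M = "{..i + d + e}"])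
      (use assms in \<open>auto simp: hess_def\<close>)
qed

lemma imat_mult_assoc_outer:
  assumes "hess d A" "hess e (imat_transpose C)"
  shows "(A \<odot> B) \<odot> C = A \<odot> (B \<odot> C)"
proof (intro ext)
  fix i j
  show "((A \<odot> B) \<odot> C) i j = (A \<odot> (B \<odot> C)) i j"
    by (rule imat_mult_assoc_entry[where K = "{..i + d}" and M = "{..j + e}"])
      (use assms in \<open>auto simp: hess_def imat_transpose_def\<close>)
qed

lemma hess_left_diff_distrib:
  assumes "hess d A" "hess d B"
  shows "((\<lambda>i j. A i j - B i j) \<odot> C) i j = (A \<odot> C) i j - (B \<odot> C) i j"
proof -
  have "hess d (\<lambda>i j. A i j - B i j)" using assms by (simp add: hess_def)
  then show ?thesis
    using assms by (simp add: hess_mult_eq_sum[OF _ order_refl] left_diff_distrib sum_subtractf)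
qed

lemma hess_right_diff_distrib:
  assumes "hess d A"
  shows "(A \<odot> (\<lambda>i j. B i j - C i j)) i j = (A \<odot> B) i j - (A \<odot> C) i j"
  using assms by (simp add: hess_mult_eq_sum[OF _ order_refl] right_diff_distrib sum_subtractf)

lemma imat_pow_commute:
  assumes "hess d A"
  shows "imat_pow A n \<odot> A = A \<odot> imat_pow A n"
proof (induction n)
  case (Suc n)
  have "imat_pow A (Suc n) \<odot> A = A \<odot> (imat_pow A n \<odot> A)"
    using imat_mult_assoc_hess[OF assms hess_pow[OF assms]] by simp
  then show ?case by (simp add: Suc.IH)
qed simp

lemma imat_pow_conjugate:
  assumes A: "hess a A" and X: "hess b X" and N: "hess d N" and XA: "X \<odot> A = imat_one" and AX: "A \<odot> X = imat_one"
  shows "imat_pow (A \<odot> N \<odot> X) n = A \<odot> imat_pow N n \<odot> X"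
proof (induction n)
  case 0
  show ?case by (simp add: AX)
next
  case (Suc n)
  let ?P = "imat_pow N n"
  note AN = hess_mult[OF A N] and NP = hess_pow[OF N, of n]
  have "imat_pow (A \<odot> N \<odot> X) (Suc n) = (A \<odot> N \<odot> X) \<odot> (A \<odot> (?P \<odot> X))"
    by (simp add: Suc.IH imat_mult_assoc_hess[OF A NP])
  also have "\<dots> = ((A \<odot> N \<odot> X) \<odot> A) \<odot> (?P \<odot> X)"
    by (rule imat_mult_assoc_hess[OF hess_mult[OF AN X] A, symmetric])
  also have "(A \<odot> N \<odot> X) \<odot> A = A \<odot> N"
    by (simp add: imat_mult_assoc_hess[OF AN X] XA)
  also have "(A \<odot> N) \<odot> (?P \<odot> X) = A \<odot> (N \<odot> ?P) \<odot> X"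
    by (simp add: imat_mult_assoc_hess[OF AN NP, symmetric] imat_mult_assoc_hess[OF A N, of ?P])
  finally show ?case by simp
qed

fun tri_inv :: "imat \<Rightarrow> imat" where
  "tri_inv A i j = ((if i = j then 1 else 0) - (\<Sum>k<i. A i k * tri_inv A k j)) / A i i"

declare tri_inv.simps [simp del]

text \<open>Forward substitution: row \<open>i\<close> of \<open>B\<close> is determined by row \<open>i\<close> of \<open>A \<odot> B\<close> and the earlier rows of \<open>B\<close>.
This yields uniqueness of inverses and turns one-sided inverses into two-sided ones.\<close>

lemma lower_triangular_cancel:
  assumes A: "hess 0 A" "\<And>i. A i i \<noteq> 0" and eq: "A \<odot> B = A \<odot> C"
  shows "B = C"
proof (intro ext)
  fix i j
  show "B i j = C i j"
  proof (induction i rule: less_induct)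
    case (less i)
    have exp: "(A \<odot> D) i j = (\<Sum>k<i. A i k * D k j) + A i i * D i j" for D
      using hess_mult_eq_sum[OF A(1), of i i] by (simp add: lessThan_Suc_atMost[symmetric])
    have "(\<Sum>k<i. A i k * B k j) = (\<Sum>k<i. A i k * C k j)"
      using less by simp
    moreover have "(A \<odot> B) i j = (A \<odot> C) i j" by (simp add: eq)
    ultimately show ?case using A(2) by (simp add: exp)
  qed
qed

lemma tri_inv_lower: "hess 0 (tri_inv A)"
proof -
  have "i < j \<Longrightarrow> tri_inv A i j = 0" for i j
  proof (induction i rule: less_induct)
    case (less i)
    then show ?case by (subst tri_inv.simps) simp
  qed
  then show ?thesis by (simp add: hess_def)
qed

lemma tri_inv_inverse:
  assumes A: "hess 0 A" "\<And>i. A i i \<noteq> 0"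
  shows "A \<odot> tri_inv A = imat_one" and "tri_inv A \<odot> A = imat_one"
proof -
  show right: "A \<odot> tri_inv A = imat_one"
  proof (intro ext)
    fix i j
    have "(A \<odot> tri_inv A) i j = (\<Sum>k<i. A i k * tri_inv A k j) + A i i * tri_inv A i j"
      using hess_mult_eq_sum[OF A(1), of i i] by (simp add: lessThan_Suc_atMost[symmetric])
    also have "A i i * tri_inv A i j = (if i = j then 1 else 0) - (\<Sum>k<i. A i k * tri_inv A k j)"
      using A(2)[of i] by (subst tri_inv.simps) simp
    finally show "(A \<odot> tri_inv A) i j = imat_one i j" by (simp add: imat_one_def)
  qed
  have "A \<odot> (tri_inv A \<odot> A) = A \<odot> imat_one"
    using imat_mult_assoc_hess[OF A(1) tri_inv_lower, of A A] by (simp add: right)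
  then show "tri_inv A \<odot> A = imat_one" by (rule lower_triangular_cancel[OF A])
qed

text \<open>The definition of \<open>imat_inv\<close> asks for uniqueness among all matrices; \<open>lower_triangular_cancel\<close> gives
it, as it allows arbitrary right factors.\<close>

lemma imat_inv_lower:
  assumes A: "hess 0 A" "\<And>i. A i i \<noteq> 0"
  shows "imat_inv A = tri_inv A"
  unfolding imat_inv_def
proof (rule the_equality)
  show "A \<odot> tri_inv A = imat_one \<and> tri_inv A \<odot> A = imat_one"
    using tri_inv_inverse[OF A] by simp
  show "B = tri_inv A" if "A \<odot> B = imat_one \<and> B \<odot> A = imat_one" for B
    using that tri_inv_inverse(1)[OF A] lower_triangular_cancel[OF A, of B "tri_inv A"] by simp
qed

lemma imat_inv_transpose:
  assumes A: "hess 0 A" "\<And>i. A i i \<noteq> 0"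
  shows "imat_inv (imat_transpose A) = imat_transpose (tri_inv A)"
  unfolding imat_inv_def
proof (rule the_equality)
  show "imat_transpose A \<odot> imat_transpose (tri_inv A) = imat_one \<and>
      imat_transpose (tri_inv A) \<odot> imat_transpose A = imat_one"
    unfolding imat_transpose_mult[symmetric] tri_inv_inverse[OF A] by simp
  fix B assume "imat_transpose A \<odot> B = imat_one \<and> B \<odot> imat_transpose A = imat_one"
  then have "imat_transpose (B \<odot> imat_transpose A) = imat_one" by simp
  then have "A \<odot> imat_transpose B = A \<odot> tri_inv A"
    unfolding imat_transpose_mult tri_inv_inverse[OF A] by simp
  then have "imat_transpose B = tri_inv A" by (rule lower_triangular_cancel[OF A])
  then show "B = imat_transpose (tri_inv A)"
    using imat_transpose_transpose[of B] by simp
qed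

lemma field_differentiable_tri_inv:
  assumes A: "\<And>i j. (\<lambda>s. A s i j) field_differentiable (at x within R)"
    and diag: "\<And>i. A x i i \<noteq> 0"
  shows "(\<lambda>s. tri_inv (A s) i j) field_differentiable (at x within R)"
proof (induction i rule: less_induct)
  case (less i)
  have sum: "(\<lambda>s. \<Sum>k<i. A s i k * tri_inv (A s) k j) field_differentiable (at x within R)"
    by (rule field_differentiable_sum) (use less A in \<open>auto intro: field_differentiable_mult\<close>)
  have eq: "(\<lambda>s. tri_inv (A s) i j) = (\<lambda>s. ((if i = j then 1 else 0) -
      (\<Sum>k<i. A s i k * tri_inv (A s) k j)) / A s i i)"
    by (rule ext) (rule tri_inv.simps)
  show ?case
    unfolding eq
    by (rule field_differentiable_divide[OF field_differentiable_diff[OF field_differentiable_const sum] A diag])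
qed

lemma has_field_derivative_eq_on:
  assumes "(f has_field_derivative D) (at x within R)" "x \<in> R" "\<And>s. s \<in> R \<Longrightarrow> f s = g s"
  shows "(g has_field_derivative D) (at x within R)"
  by (rule has_field_derivative_transform_within[OF assms(1) _ assms(2), of 1]) (simp_all add: assms(3))

lemma has_field_derivative_imat_mult:
  assumes s0: "x \<in> R" and A: "\<And>s. s \<in> R \<Longrightarrow> hess d (A s)" "hess d A'"
    and dA: "\<And>i j. ((\<lambda>s. A s i j) has_field_derivative A' i j) (at x within R)"
    and dB: "\<And>i j. ((\<lambda>s. B s i j) has_field_derivative B' i j) (at x within R)"
  shows "((\<lambda>s. (A s \<odot> B s) i j) has_field_derivative (A' \<odot> B x) i j + (A x \<odot> B') i j)
    (at x within R)"
proof -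
  have "((\<lambda>s. \<Sum>k\<le>i + d. A s i k * B s k j) has_field_derivative
      (\<Sum>k\<le>i + d. A' i k * B x k j + B' k j * A x i k)) (at x within R)"
    by (rule DERIV_sum) (rule DERIV_mult[OF dA dB])
  moreover have "(\<Sum>k\<le>i + d. A' i k * B x k j + B' k j * A x i k) = (A' \<odot> B x) i j + (A x \<odot> B') i j"
    by (simp add: hess_mult_eq_sum[OF A(2) order_refl] hess_mult_eq_sum[OF A(1)[OF s0] order_refl]
        sum.distrib mult.commute)
  ultimately have "((\<lambda>s. \<Sum>k\<le>i + d. A s i k * B s k j) has_field_derivative
      (A' \<odot> B x) i j + (A x \<odot> B') i j) (at x within R)" by (simp only:)
  then show ?thesis
    by (rule has_field_derivative_eq_on[OF _ s0]) (simp add: hess_mult_eq_sum[OF A(1) order_refl])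
qed

lemma has_field_derivative_unique_within:
  assumes "at x within R \<noteq> bot" "(f has_field_derivative a) (at x within R)"
    "(f has_field_derivative b) (at x within R)"
  shows "a = b"
proof -
  have "((\<lambda>y. (f y - f x) / (y - x)) \<longlongrightarrow> a) (at x within R)"
    "((\<lambda>y. (f y - f x) / (y - x)) \<longlongrightarrow> b) (at x within R)"
    using assms(2,3) by (simp_all only: has_field_derivative_iff)
  then show ?thesis by (rule tendsto_unique[OF assms(1)])
qed

section \<open>Toeplitz and CMV moment matrices\<close>

definition toeplitz :: "(int \<Rightarrow> complex) \<Rightarrow> imat" where
  "toeplitz c i j = c (int i - int j)"

definition cmv_exponent :: "nat \<Rightarrow> int" where
  "cmv_exponent i = (if even i then int (i div 2) else - int (Suc i div 2))"

definition cmv_matrix :: "(int \<Rightarrow> complex) \<Rightarrow> imat" where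
  "cmv_matrix c i j = c (cmv_exponent i - cmv_exponent j)"

definition nondegenerate :: "(int \<Rightarrow> complex) \<Rightarrow> bool" where
  "nondegenerate c \<longleftrightarrow>
    (\<forall>n. Determinant.det (mat (Suc n) (Suc n) (\<lambda>(i, j). c (int i - int j))) \<noteq> 0)"

lemma block_nonsingular_if_det:
  assumes "Determinant.det (mat n n (\<lambda>(i, j). g i j)) \<noteq> 0"
  shows "block_nonsingular g n"
  unfolding block_nonsingular_def
proof (intro allI impI)
  fix x :: "nat \<Rightarrow> complex" and i
  assume x: "\<forall>j<n. (\<Sum>i<n. x i * g i j) = 0" and i: "i < n"
  define A where "A = transpose_mat (mat n n (\<lambda>(i, j). g i j))"
  have A: "A \<in> carrier_mat n n" by (simp add: A_def)
  have "Determinant.det A \<noteq> 0"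
    using assms by (simp add: A_def Determinant.det_transpose[of _ n])
  moreover have "A *\<^sub>v vec n x = 0\<^sub>v n"
  proof (rule eq_vecI)
    fix j assume j: "j < dim_vec (0\<^sub>v n :: complex vec)"
    then have "(A *\<^sub>v vec n x) $ j = (\<Sum>i<n. g i j * x i)"
      by (simp add: A_def scalar_prod_def atLeast0LessThan)
    also have "\<dots> = 0" using x j by (simp add: mult.commute)
    finally show "(A *\<^sub>v vec n x) $ j = 0\<^sub>v n $ j" using j by simp
  qed (simp add: A_def)
  ultimately have "vec n x = 0\<^sub>v n"
    using det_0_iff_vec_prod_zero[OF A] vec_carrier[of n x] by blast
  then have "vec n x $ i = 0\<^sub>v n $ i" by simp
  then show "x i = 0" using i by simp
qed

lemma nondegenerate_toeplitz: "nondegenerate c \<Longrightarrow> block_nonsingular (toeplitz c) n"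
proof (cases n)
  case (Suc m)
  assume "nondegenerate c"
  then show ?thesis
    unfolding Suc by (intro block_nonsingular_if_det) (simp add: nondegenerate_def toeplitz_def)
qed (simp add: block_nonsingular_def)

text \<open>Reversing the moments, that is, replacing \<open>z\<close> by \<open>1/z\<close>, transposes the Toeplitz matrices.\<close>

lemma nondegenerate_reverse:
  assumes "nondegenerate c"
  shows "nondegenerate (\<lambda>n. c (- n))"
  unfolding nondegenerate_def
proof
  fix n
  let ?M = "mat (Suc n) (Suc n) (\<lambda>(i, j). c (int i - int j))"
  have "mat (Suc n) (Suc n) (\<lambda>(i, j). c (- (int i - int j))) = transpose_mat ?M"
    by (rule eq_matI) auto
  then show "Determinant.det (mat (Suc n) (Suc n) (\<lambda>(i, j). c (- (int i - int j)))) \<noteq> 0"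
    using assms by (simp add: Determinant.det_transpose[of _ "Suc n"] nondegenerate_def)
qed

text \<open>The first \<open>n\<close> exponents \<open>0, -1, 1, -2, \<dots>\<close> fill the interval of \<open>n\<close> integers that starts at
\<open>- (n div 2)\<close>. So the leading blocks of the CMV moment matrix are Toeplitz blocks with rows and columns
permuted alike, and they inherit non-singularity.\<close>

lemma bij_betw_cmv_exponent:
  "bij_betw (\<lambda>k. nat (cmv_exponent k + int (n div 2))) {..<n} {..<n}"
proof (rule bij_betw_byWitness[where f' = "\<lambda>p. if n div 2 \<le> p then 2 * (p - n div 2)
      else 2 * (n div 2 - p) - 1"])
  show "\<forall>k\<in>{..<n}. (if n div 2 \<le> nat (cmv_exponent k + int (n div 2))
      then 2 * (nat (cmv_exponent k + int (n div 2)) - n div 2)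
      else 2 * (n div 2 - nat (cmv_exponent k + int (n div 2))) - 1) = k"
    by (auto simp: cmv_exponent_def elim!: evenE oddE)
  show "\<forall>p\<in>{..<n}. nat (cmv_exponent (if n div 2 \<le> p then 2 * (p - n div 2)
      else 2 * (n div 2 - p) - 1) + int (n div 2)) = p"
    by (auto simp: cmv_exponent_def)
  show "(\<lambda>k. nat (cmv_exponent k + int (n div 2))) ` {..<n} \<subseteq> {..<n}"
    by (auto simp: cmv_exponent_def elim!: evenE oddE)
  show "(\<lambda>p. if n div 2 \<le> p then 2 * (p - n div 2) else 2 * (n div 2 - p) - 1) ` {..<n} \<subseteq> {..<n}"
    by auto
qed

lemma cmv_exponent_lower: "k < n \<Longrightarrow> 0 \<le> cmv_exponent k + int (n div 2)"
  by (auto simp: cmv_exponent_def elim!: evenE oddE)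

lemma nondegenerate_cmv:
  assumes "nondegenerate c"
  shows "block_nonsingular (cmv_matrix c) n"
  unfolding block_nonsingular_def
proof (intro allI impI)
  fix x :: "nat \<Rightarrow> complex" and i
  assume x: "\<forall>j<n. (\<Sum>i<n. x i * cmv_matrix c i j) = 0" and i: "i < n"
  define \<tau> where "\<tau> k = nat (cmv_exponent k + int (n div 2))" for k
  have bij: "bij_betw \<tau> {..<n} {..<n}"
    using bij_betw_cmv_exponent[of n] by (simp add: \<tau>_def[abs_def])
  then have inj: "inj_on \<tau> {..<n}" by (rule bij_betw_imp_inj_on)
  define y where "y p = x (inv_into {..<n} \<tau> p)" for p
  have y: "y (\<tau> k) = x k" if "k < n" for k
    using inv_into_f_f[OF inj] that by (simp add: y_def)
  have "(\<Sum>p<n. y p * toeplitz c p q) = 0" if "q < n" for q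
  proof -
    have "q \<in> \<tau> ` {..<n}" using bij that by (simp add: bij_betw_def)
    then obtain j where j: "j < n" "q = \<tau> j" by auto
    have "(\<Sum>p<n. y p * toeplitz c p q) = (\<Sum>k<n. y (\<tau> k) * toeplitz c (\<tau> k) (\<tau> j))"
      unfolding j(2) by (rule sum.reindex_bij_betw[OF bij, symmetric])
    also have "\<dots> = (\<Sum>k<n. x k * cmv_matrix c k j)"
    proof (rule sum.cong[OF refl])
      fix k assume "k \<in> {..<n}"
      then show "y (\<tau> k) * toeplitz c (\<tau> k) (\<tau> j) = x k * cmv_matrix c k j"
        using y[of k] cmv_exponent_lower[of k n] cmv_exponent_lower[OF j(1)]
        by (simp add: toeplitz_def cmv_matrix_def \<tau>_def)
    qed
    also have "\<dots> = 0" using x j(1) by blast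
    finally show ?thesis .
  qed
  then have "\<forall>p<n. y p = 0"
    using nondegenerate_toeplitz[OF assms, of n] unfolding block_nonsingular_def by blast
  moreover have "\<tau> i < n" using bij_betwE[OF bij] i by auto
  ultimately show "x i = 0" using y[OF i] by auto
qed

section \<open>The Gauss-Borel factorization\<close>

lemma lower_unitriangular_hess:
  assumes "lower_unitriangular A"
  shows "hess 0 A" "A i i \<noteq> 0"
  using assms by (auto simp: lower_unitriangular_def hess_def)

lemma all_pivots_nonzero:
  assumes "\<And>n. block_nonsingular g n"
  shows "pivots_nonzero g n" "upper_factor g i i \<noteq> 0"
proof -
  show p: "pivots_nonzero g n" for n by (rule pivots_nonzero_if_nonsingular[OF assms])
  show "upper_factor g i i \<noteq> 0" using p[of "Suc i"] by (simp add: pivots_nonzero_def)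
qed

lemma lower_factor_imat_mult: "lower_factor g \<odot> g = upper_factor g"
  by (intro ext) (simp add: factor_mult[OF order_refl]
      hess_mult_eq_sum[OF lower_unitriangular_hess(1)[OF lower_unitriangular_lower_factor]])

lemma upper_factor_transpose:
  assumes "\<And>n. block_nonsingular g n"
  shows "hess 0 (imat_transpose (upper_factor g))" "imat_transpose (upper_factor g) i i \<noteq> 0"
  using upper_factor_eq_0[OF all_pivots_nonzero(1)[OF assms]] all_pivots_nonzero(2)[OF assms]
  by (auto simp: hess_def imat_transpose_def)

text \<open>If \<open>A \<odot> g\<close> is upper triangular, row \<open>n\<close> of \<open>A\<close> minus row \<open>n\<close> of the lower factor is supported in the
first \<open>n\<close> columns and is a left null vector of the leading block of size \<open>n\<close>, so it vanishes.\<close>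

lemma gauss_borel_unique:
  assumes g: "\<And>n. block_nonsingular g n"
  shows "(THE (S1, S2). lower_unitriangular S1 \<and> upper_triang S2 \<and> g = imat_inv S1 \<odot> S2) =
    (lower_factor g, upper_factor g)"
proof (rule the_equality)
  note unit = lower_unitriangular_lower_factor[of g]
  note low = lower_unitriangular_hess[OF unit]
  have "tri_inv (lower_factor g) \<odot> upper_factor g = g"
    by (simp add: lower_factor_imat_mult[symmetric]
        imat_mult_assoc_hess[OF tri_inv_lower low(1), symmetric] tri_inv_inverse[OF low])
  then show "case (lower_factor g, upper_factor g) of (S1, S2) \<Rightarrow>
      lower_unitriangular S1 \<and> upper_triang S2 \<and> g = imat_inv S1 \<odot> S2"
    using unit upper_factor_eq_0[OF all_pivots_nonzero(1)[OF g]]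
    by (simp add: imat_inv_lower[OF low] upper_triang_def)
  fix P assume P: "case P of (S1, S2) \<Rightarrow>
      lower_unitriangular S1 \<and> upper_triang S2 \<and> g = imat_inv S1 \<odot> S2"
  obtain A B where AB: "P = (A, B)" by (cases P)
  have A: "lower_unitriangular A" and B: "upper_triang B" and gAB: "g = imat_inv A \<odot> B"
    using P unfolding AB prod.case by (rule conjunct1, rule conjunct1[OF conjunct2], rule conjunct2[OF conjunct2])
  note lowA = lower_unitriangular_hess[OF A]
  have Ag: "A \<odot> g = B"
    unfolding gAB imat_inv_lower[OF lowA] imat_mult_assoc_hess[OF lowA(1) tri_inv_lower, symmetric]
    by (simp add: tri_inv_inverse[OF lowA])
  have "A = lower_factor g"
  proof (intro ext)
    fix n i
    have "(\<Sum>i<n. (A n i - lower_factor g n i) * g i j) = 0" if "j < n" for j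
    proof -
      have row: "(C \<odot> g) n j = (\<Sum>i<n. C n i * g i j) + g n j" if "lower_unitriangular C" for C
        using hess_mult_eq_sum[OF lower_unitriangular_hess(1)[OF that], of n n g j] that
        by (simp add: lessThan_Suc_atMost[symmetric] lower_unitriangular_def)
      have "(A \<odot> g) n j = 0" using B that by (simp add: Ag upper_triang_def)
      moreover have "(lower_factor g \<odot> g) n j = 0"
        using upper_factor_eq_0[OF all_pivots_nonzero(1)[OF g] that] by (simp add: lower_factor_imat_mult)
      ultimately have "(\<Sum>i<n. A n i * g i j) = (\<Sum>i<n. lower_factor g n i * g i j)"
        using row[OF A] row[OF unit] by (metis add_right_cancel)
      then show ?thesis by (simp add: left_diff_distrib sum_subtractf)
    qed
    then have *: "A n k - lower_factor g n k = 0" if "k < n" for k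
      using g[of n, unfolded block_nonsingular_def, rule_format,
          of "\<lambda>i. A n i - lower_factor g n i" k] that by blast
    consider "i < n" | "i = n" | "n < i" by linarith
    then show "A n i = lower_factor g n i"
    proof cases
      case 1
      then show ?thesis using *[of i] by simp
    qed (use A unit in \<open>simp_all add: lower_unitriangular_def\<close>)
  qed
  then show "P = (lower_factor g, upper_factor g)"
    using Ag unfolding AB by (simp add: lower_factor_imat_mult[symmetric])
qed

section \<open>Lax matrices\<close>

definition lax1_of :: "(int \<Rightarrow> complex) \<Rightarrow> imat" where
  "lax1_of c = (let S = lower_factor (cmv_matrix c) in S \<odot> cmv_shift \<odot> tri_inv S)"

text \<open>The second Lax matrix is handled through its transpose, in which all factors are lower Hessenberg. It
is a conjugate of the same shift, by the inverse of the transposed upper factor.\<close>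

definition lax2_transpose_of :: "(int \<Rightarrow> complex) \<Rightarrow> imat" where
  "lax2_transpose_of c = (let T = imat_transpose (upper_factor (cmv_matrix c))
    in tri_inv T \<odot> cmv_shift \<odot> T)"

lemma hess_cmv_shift: "hess 2 cmv_shift"
  by (auto simp: hess_def cmv_shift_def)

lemma hess_lax1_of: "hess 2 (lax1_of c)"
  using hess_mult[OF hess_mult[OF lower_unitriangular_hess(1)[OF lower_unitriangular_lower_factor]
      hess_cmv_shift] tri_inv_lower]
  by (simp add: lax1_of_def Let_def numeral_2_eq_2)

lemma hess_lax2_transpose_of:
  assumes "nondegenerate c"
  shows "hess 2 (lax2_transpose_of c)"
  using hess_mult[OF hess_mult[OF tri_inv_lower hess_cmv_shift]
      upper_factor_transpose(1)[OF nondegenerate_cmv[OF assms]]]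
  by (simp add: lax2_transpose_of_def Let_def numeral_2_eq_2)

lemma lax_eq:
  assumes "cmv_moment \<nu> = cmv_matrix c" "nondegenerate c"
  shows "lax1 \<nu> = lax1_of c" "lax2 \<nu> = imat_transpose (lax2_transpose_of c)"
proof -
  let ?g = "cmv_matrix c"
  have "gauss_borel \<nu> = (lower_factor ?g, upper_factor ?g)"
    unfolding gauss_borel_def assms(1) by (rule gauss_borel_unique[OF nondegenerate_cmv[OF assms(2)]])
  note gb = this
  show "lax1 \<nu> = lax1_of c"
    by (simp add: lax1_def gb lax1_of_def Let_def
        imat_inv_lower[OF lower_unitriangular_hess[OF lower_unitriangular_lower_factor]])
  let ?T = "imat_transpose (upper_factor ?g)"
  note T = upper_factor_transpose[OF nondegenerate_cmv[OF assms(2)]]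
  have "imat_inv (upper_factor ?g) = imat_transpose (tri_inv ?T)"
    using imat_inv_transpose[OF T] by simp
  then have "lax2 \<nu> = imat_transpose (tri_inv ?T \<odot> (cmv_shift \<odot> ?T))"
    by (simp add: lax2_def gb imat_transpose_mult)
  then show "lax2 \<nu> = imat_transpose (lax2_transpose_of c)"
    by (simp add: lax2_transpose_of_def Let_def imat_mult_assoc_hess[OF tri_inv_lower hess_cmv_shift])
qed

text \<open>The position of \<open>z\<close> times the \<open>i\<close>-th entry of \<open>\<chi>(z)\<close>: \<open>cmv_shift\<close> is the matrix of multiplication by
\<open>z\<close>, and its powers move the rows of the moment matrix.\<close>

definition cmv_succ :: "nat \<Rightarrow> nat" where
  "cmv_succ i = (if even i then i + 2 else if i = 1 then 0 else i - 2)"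

lemma cmv_shift_eq: "cmv_shift i j = (if j = cmv_succ i then 1 else 0)"
proof -
  have even: "(\<exists>k. i = 2 * k \<and> j = 2 * k + 2) \<longleftrightarrow> even i \<and> j = i + 2"
    by (auto elim!: evenE)
  have odd: "(\<exists>k. i = 2 * k + 3 \<and> j = 2 * k + 1) \<longleftrightarrow> odd i \<and> i \<noteq> 1 \<and> j = i - 2"
  proof
    assume "odd i \<and> i \<noteq> 1 \<and> j = i - 2"
    then obtain k where "i = 2 * k + 1" "k \<noteq> 0" "j = i - 2" by (auto elim!: oddE)
    then show "\<exists>k. i = 2 * k + 3 \<and> j = 2 * k + 1" by (intro exI[of _ "k - 1"]) auto
  qed auto
  show ?thesis unfolding cmv_shift_def even odd by (auto simp: cmv_succ_def)
qed

lemma cmv_exponent_succ: "cmv_exponent (cmv_succ i) = cmv_exponent i + 1"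
  by (auto simp: cmv_exponent_def cmv_succ_def elim!: evenE oddE)

lemma cmv_exponent_funpow: "cmv_exponent ((cmv_succ ^^ n) i) = cmv_exponent i + int n"
  by (induction n) (auto simp: cmv_exponent_succ)

lemma cmv_shift_mult: "(cmv_shift \<odot> h) i j = h (cmv_succ i) j"
proof -
  have "(cmv_shift \<odot> h) i j = (\<Sum>k\<in>{cmv_succ i}. cmv_shift i k * h k j)"
    by (rule imat_mult_eq_sum) (auto simp: cmv_shift_eq)
  then show ?thesis by (simp add: cmv_shift_eq)
qed

lemma cmv_shift_pow_mult: "(imat_pow cmv_shift n \<odot> h) i j = h ((cmv_succ ^^ n) i) j"
proof (induction n arbitrary: i)
  case (Suc n)
  have "imat_pow cmv_shift (Suc n) \<odot> h = cmv_shift \<odot> (imat_pow cmv_shift n \<odot> h)"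
    using imat_mult_assoc_hess[OF hess_cmv_shift hess_pow[OF hess_cmv_shift]] by simp
  then have "(imat_pow cmv_shift (Suc n) \<odot> h) i j = (imat_pow cmv_shift n \<odot> h) (cmv_succ i) j"
    by (simp only: cmv_shift_mult)
  then show ?case by (simp add: Suc.IH funpow_swap1 del: imat_pow.simps)
qed simp

lemma imat_transpose_pow:
  assumes "hess d (imat_transpose A)"
  shows "imat_transpose (imat_pow A n) = imat_pow (imat_transpose A) n"
proof (induction n)
  case (Suc n)
  then show ?case
    using imat_pow_commute[OF assms, of n] by (simp add: imat_transpose_mult)
qed simp

section \<open>Lax equations\<close>

lemma has_field_derivative_zero_on:
  assumes "at x within R \<noteq> bot" "x \<in> R" "(f has_field_derivative D) (at x within R)"
    and "\<And>s. s \<in> R \<Longrightarrow> f s = c"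
  shows "D = 0"
proof (rule has_field_derivative_unique_within[OF assms(1,3)])
  show "(f has_field_derivative 0) (at x within R)"
    by (rule has_field_derivative_eq_on[OF DERIV_const assms(2)]) (simp add: assms(4))
qed

lemma entrywise_derivative_exists:
  assumes diff: "\<And>i j. (\<lambda>s. A s i j) field_differentiable (at x within R)" and x: "x \<in> R"
    and nontriv: "at x within R \<noteq> bot"
  shows "\<exists>A' :: imat. (\<forall>i j. ((\<lambda>s. A s i j) has_field_derivative A' i j) (at x within R)) \<and>
    (\<forall>i j c. (\<forall>s\<in>R. A s i j = c) \<longrightarrow> A' i j = 0)"
proof -
  have "\<forall>i j. \<exists>D. ((\<lambda>s. A s i j) has_field_derivative D) (at x within R)"
    using diff by (simp add: field_differentiable_def)
  then obtain A' where A': "\<And>i j. ((\<lambda>s. A s i j) has_field_derivative A' i j) (at x within R)"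
    by metis
  show ?thesis
    by (intro exI[of _ A'] conjI allI impI A' has_field_derivative_zero_on[OF nontriv x A']) blast
qed

text \<open>For \<open>L = A N A\<^sup>-\<^sup>1\<close> with constant \<open>N\<close>, the product rule and \<open>(A\<^sup>-\<^sup>1)' = - A\<^sup>-\<^sup>1 A' A\<^sup>-\<^sup>1\<close> give
\<open>L' = [A' A\<^sup>-\<^sup>1, L]\<close>. The set \<open>R\<close> may be thin around \<open>x\<close>, but derivatives within it are unique as soon as
\<open>x\<close> is a limit point.\<close>

lemma conjugation_derivative:
  assumes x: "x \<in> R" and nontriv: "at x within R \<noteq> bot"
    and A: "\<And>s. s \<in> R \<Longrightarrow> hess 0 (A s)" and X: "\<And>s. s \<in> R \<Longrightarrow> hess 0 (X s)"
    and inv: "\<And>s. s \<in> R \<Longrightarrow> A s \<odot> X s = imat_one" "X x \<odot> A x = imat_one"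
    and dA: "\<And>i j. ((\<lambda>s. A s i j) has_field_derivative A' i j) (at x within R)" "hess 0 A'"
    and dX: "\<And>i j. ((\<lambda>s. X s i j) has_field_derivative X' i j) (at x within R)"
    and N: "hess d N"
  shows "(A' \<odot> X x) i j = - (A x \<odot> X') i j"
    and "((\<lambda>s. (A s \<odot> N \<odot> X s) i j) has_field_derivative
      commutator (A' \<odot> X x) (A x \<odot> N \<odot> X x) i j) (at x within R)"
proof -
  note Ax = A[OF x] and Xx = X[OF x]
  have prod: "(A' \<odot> X x) i j = - (A x \<odot> X') i j" for i j
  proof -
    have "((\<lambda>s. (A s \<odot> X s) i j) has_field_derivative (A' \<odot> X x) i j + (A x \<odot> X') i j) (at x within R)"
      by (rule has_field_derivative_imat_mult[OF x A dA(2,1) dX])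
    then have "(A' \<odot> X x) i j + (A x \<odot> X') i j = 0"
      by (rule has_field_derivative_zero_on[OF nontriv x]) (simp add: inv(1))
    then show ?thesis by (simp add: eq_neg_iff_add_eq_0)
  qed
  then show "(A' \<odot> X x) i j = - (A x \<odot> X') i j" .
  define Y where "Y = (\<lambda>i j. - X' i j)"
  have neg: "(H \<odot> Y) i j = - (H \<odot> X') i j" if "hess e H" for e H i j
    by (simp add: hess_mult_eq_sum[OF that order_refl] Y_def sum_negf)
  have AY: "A' \<odot> X x = A x \<odot> Y"
    by (intro ext) (simp add: prod neg[OF Ax])
  note AN = hess_mult[OF Ax N]
  have XL: "X x \<odot> (A x \<odot> N \<odot> X x) = N \<odot> X x"
  proof -
    have "A x \<odot> N \<odot> X x = A x \<odot> (N \<odot> X x)" by (rule imat_mult_assoc_hess[OF Ax N])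
    then have "X x \<odot> (A x \<odot> N \<odot> X x) = (X x \<odot> A x) \<odot> (N \<odot> X x)"
      by (simp only: imat_mult_assoc_hess[OF Xx Ax])
    then show ?thesis by (simp add: inv(2))
  qed
  have first: "(A' \<odot> X x) \<odot> (A x \<odot> N \<odot> X x) = A' \<odot> N \<odot> X x"
    unfolding imat_mult_assoc_hess[OF dA(2) Xx] XL imat_mult_assoc_hess[OF dA(2) N] ..
  have second: "(A x \<odot> N \<odot> X x) \<odot> (A' \<odot> X x) = (A x \<odot> N) \<odot> Y"
  proof -
    have "(A x \<odot> N \<odot> X x) \<odot> (A' \<odot> X x) = (A x \<odot> N) \<odot> ((X x \<odot> A x) \<odot> Y)"
      unfolding AY imat_mult_assoc_hess[OF AN Xx] imat_mult_assoc_hess[OF Xx Ax] ..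
    then show ?thesis by (simp add: inv(2))
  qed
  have dN: "((\<lambda>s. (A s \<odot> N) i j) has_field_derivative (A' \<odot> N) i j) (at x within R)" for i j
  proof -
    have "((\<lambda>s. (A s \<odot> N) i j) has_field_derivative
        (A' \<odot> N) i j + (A x \<odot> (\<lambda>i j. 0)) i j) (at x within R)"
      by (rule has_field_derivative_imat_mult[OF x A dA(2,1)]) (assumption, rule DERIV_const)
    then show ?thesis by (simp add: imat_mult_def)
  qed
  have "((\<lambda>s. (A s \<odot> N \<odot> X s) i j) has_field_derivative
      (A' \<odot> N \<odot> X x) i j + (A x \<odot> N \<odot> X') i j) (at x within R)"
    using hess_mult[OF A N] hess_mult[OF dA(2) N]
    by (intro has_field_derivative_imat_mult[OF x _ _ dN dX]) auto
  then show "((\<lambda>s. (A s \<odot> N \<odot> X s) i j) has_field_derivative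
      commutator (A' \<odot> X x) (A x \<odot> N \<odot> X x) i j) (at x within R)"
    by (simp add: commutator_def first second neg[OF AN])
qed

lemma commutator_transpose:
  "commutator (imat_transpose A) (imat_transpose B) i j = - commutator A B j i"
  unfolding commutator_def imat_transpose_mult[symmetric] by (simp add: imat_transpose_def)

text \<open>Powers of \<open>L\<close> commute with \<open>L\<close>, so in a commutator with \<open>L\<close> the upper triangular part of \<open>L\<^sup>n\<close> may be
replaced by minus the strictly lower part, and conversely.\<close>

lemma commutator_diff_pow:
  assumes "hess d B" "hess e L"
  shows "commutator (\<lambda>i j. B i j - imat_pow L n i j) L i j = commutator B L i j"
proof -
  have B: "hess (d + n * e) B" and P: "hess (d + n * e) (imat_pow L n)"
    using hess_mono[OF assms(1)] hess_mono[OF hess_pow[OF assms(2), of n]] by auto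
  show ?thesis
    unfolding commutator_def hess_left_diff_distrib[OF B P] hess_right_diff_distrib[OF assms(2)]
      imat_pow_commute[OF assms(2)] by simp
qed

lemma imat_mult_add_outer:
  assumes "hess d (imat_transpose C)" "\<And>i j. D i j = A i j + \<sigma> * B i j"
  shows "(D \<odot> C) i j = (A \<odot> C) i j + \<sigma> * (B \<odot> C) i j"
proof -
  have sum: "(H \<odot> C) i j = (\<Sum>k\<le>j + d. H i k * C k j)" for H
    by (rule imat_mult_eq_sum) (use assms(1) in \<open>auto simp: hess_def imat_transpose_def\<close>)
  show ?thesis
    by (simp add: sum assms(2) distrib_right sum.distrib sum_distrib_left mult.assoc)
qed

text \<open>In the proof \<open>V = S' S\<^sup>-\<^sup>1\<close> and \<open>W = U' U\<^sup>-\<^sup>1\<close>, and \<open>Q\<close> is the power of a Lax matrix that belongs to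
the flow. The relation \<open>W = V + \<sigma> Q\<close> splits \<open>Q\<close> into triangular parts; \<open>V\<close> then drives \<open>L\<^sub>1\<close> and \<open>W\<close>
drives \<open>L\<^sub>2\<close>.\<close>

lemma lax_derivative:
  fixes c :: "complex \<Rightarrow> int \<Rightarrow> complex" and \<sigma> :: int
  assumes x: "x \<in> R" and nontriv: "at x within R \<noteq> bot"
    and nd: "\<And>s. s \<in> R \<Longrightarrow> nondegenerate (c s)"
    and dc: "\<And>n. ((\<lambda>s. c s n) has_field_derivative of_int \<sigma> * c x (n + \<sigma> * int p)) (at x within R)"
    and \<sigma>: "\<sigma> = 1 \<or> \<sigma> = -1"
  defines "B \<equiv> if \<sigma> = 1 then upper_part (imat_pow (lax1_of (c x)) p)
    else strict_lower_part (imat_pow (imat_transpose (lax2_transpose_of (c x))) p)"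
  shows "((\<lambda>s. lax1_of (c s) i j) has_field_derivative commutator B (lax1_of (c x)) i j) (at x within R)"
    and "((\<lambda>s. imat_transpose (lax2_transpose_of (c s)) i j) has_field_derivative
      commutator B (imat_transpose (lax2_transpose_of (c x))) i j) (at x within R)"
proof -
  define g where "g s = cmv_matrix (c s)" for s
  define S where "S s = lower_factor (g s)" for s
  define U where "U s = upper_factor (g s)" for s
  define T where "T s = imat_transpose (U s)" for s
  define X where "X s = tri_inv (S s)" for s
  define Y where "Y s = tri_inv (T s)" for s
  define L1 where "L1 = lax1_of (c x)"
  define M where "M = lax2_transpose_of (c x)"
  define L2 where "L2 = imat_transpose M"
  have block: "block_nonsingular (g s) n" if "s \<in> R" for s n
    unfolding g_def by (rule nondegenerate_cmv[OF nd[OF that]])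
  have unit: "lower_unitriangular (S s)" for s
    unfolding S_def by (rule lower_unitriangular_lower_factor)
  note S = lower_unitriangular_hess[OF unit]
  have T: "hess 0 (T s)" "T s i i \<noteq> 0" if "s \<in> R" for s i
    unfolding T_def U_def using upper_factor_transpose[OF block[OF that]] by auto
  have X: "hess 0 (X s)" and Y: "hess 0 (Y s)" for s
    unfolding X_def Y_def by (rule tri_inv_lower)+
  have SX: "S s \<odot> X s = imat_one" "X s \<odot> S s = imat_one" for s
    unfolding X_def by (rule tri_inv_inverse[OF S])+
  have TY: "T s \<odot> Y s = imat_one" "Y s \<odot> T s = imat_one" if "s \<in> R" for s
    unfolding Y_def by (rule tri_inv_inverse[OF T[OF that]])+
  have lax1: "lax1_of (c s) = S s \<odot> cmv_shift \<odot> X s" for s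
    by (simp add: lax1_of_def Let_def X_def S_def g_def)
  have lax2: "lax2_transpose_of (c s) = Y s \<odot> cmv_shift \<odot> T s" for s
    by (simp add: lax2_transpose_of_def Let_def Y_def T_def U_def g_def)

  have dg: "((\<lambda>s. g s i j) has_field_derivative
      of_int \<sigma> * c x (cmv_exponent i - cmv_exponent j + \<sigma> * int p)) (at x within R)" for i j
    unfolding g_def cmv_matrix_def by (rule dc)
  then have g_diff: "(\<lambda>s. g s i j) field_differentiable (at x within R)" for i j
    by (auto simp: field_differentiable_def)
  have S_diff: "(\<lambda>s. S s i j) field_differentiable (at x within R)" for i j
    unfolding S_def lower_factor_def
    by (rule field_differentiable_elim(2)[OF g_diff all_pivots_nonzero(1)[OF block[OF x]]])
  have U_diff: "(\<lambda>s. U s i j) field_differentiable (at x within R)" for i j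
    unfolding U_def upper_factor_def
    by (rule field_differentiable_elim(1)[OF g_diff all_pivots_nonzero(1)[OF block[OF x]]])
  have T_diff: "(\<lambda>s. T s i j) field_differentiable (at x within R)" for i j
    unfolding T_def imat_transpose_def by (rule U_diff)
  have X_diff: "(\<lambda>s. X s i j) field_differentiable (at x within R)" for i j
    unfolding X_def by (rule field_differentiable_tri_inv[OF S_diff S(2)])
  have Y_diff: "(\<lambda>s. Y s i j) field_differentiable (at x within R)" for i j
    unfolding Y_def by (rule field_differentiable_tri_inv[OF T_diff T(2)[OF x]])

  obtain S' where "\<forall>i j. ((\<lambda>s. S s i j) has_field_derivative S' i j) (at x within R)"
    and "\<forall>i j c. (\<forall>s\<in>R. S s i j = c) \<longrightarrow> S' i j = 0"
    using entrywise_derivative_exists[where A = S, OF S_diff x nontriv] by (elim exE conjE) (rule that)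
  note dS = this(1)[rule_format] and S'0 = this(2)[rule_format]
  obtain T' where "\<forall>i j. ((\<lambda>s. T s i j) has_field_derivative T' i j) (at x within R)"
    and "\<forall>i j c. (\<forall>s\<in>R. T s i j = c) \<longrightarrow> T' i j = 0"
    using entrywise_derivative_exists[where A = T, OF T_diff x nontriv] by (elim exE conjE) (rule that)
  note dT = this(1)[rule_format] and T'0 = this(2)[rule_format]
  obtain X' where "\<forall>i j. ((\<lambda>s. X s i j) has_field_derivative X' i j) (at x within R)"
    and "\<forall>i j c. (\<forall>s\<in>R. X s i j = c) \<longrightarrow> X' i j = 0"
    using entrywise_derivative_exists[where A = X, OF X_diff x nontriv] by (elim exE conjE) (rule that)
  note dX = this(1)[rule_format]
  obtain Y' where "\<forall>i j. ((\<lambda>s. Y s i j) has_field_derivative Y' i j) (at x within R)"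
    and "\<forall>i j c. (\<forall>s\<in>R. Y s i j = c) \<longrightarrow> Y' i j = 0"
    using entrywise_derivative_exists[where A = Y, OF Y_diff x nontriv] by (elim exE conjE) (rule that)
  note dY = this(1)[rule_format] and Y'0 = this(2)[rule_format]
  have S'_strict: "S' i j = 0" if "i \<le> j" for i j
    using that unit by (intro S'0[of i j "if i = j then 1 else 0"]) (auto simp: lower_unitriangular_def)
  have S': "hess 0 S'" using S'_strict by (simp add: hess_def)
  have T': "hess 0 T'" unfolding hess_def using hessD[OF T(1)] by (auto intro!: T'0)
  have Y': "hess 0 Y'" unfolding hess_def using hessD[OF Y] by (auto intro!: Y'0)

  define V where "V = S' \<odot> X x"
  define W where "W = imat_transpose T' \<odot> imat_transpose (Y x)"
  have Wt: "imat_transpose W = Y x \<odot> T'" by (simp add: W_def imat_transpose_mult)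
  have hV: "hess 0 V" unfolding V_def using hess_mult[OF S' X] by simp
  have V_strict: "V i j = 0" if "i \<le> j" for i j
  proof -
    have "S' i k * X x k j = 0" if "k \<le> i" for k
      using S'_strict[of i k] hessD[OF X, of k j x] \<open>i \<le> j\<close> that by (cases "k = i") auto
    then show ?thesis
      unfolding V_def hess_mult_eq_sum[OF S' order_refl] by (intro sum.neutral) auto
  qed
  have hWt: "hess 0 (imat_transpose W)" unfolding Wt using hess_mult[OF Y T'] by simp
  have W_upper: "W i j = 0" if "j < i" for i j
    using hessD[OF hWt, of j i] that by (simp add: imat_transpose_def)

  have hM: "hess 2 M" unfolding M_def by (rule hess_lax2_transpose_of[OF nd[OF x]])
  have L2_pow: "imat_transpose (imat_pow L2 p) = imat_pow M p"
    using imat_transpose_pow[of 2 L2 p] hM by (simp add: L2_def)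

  \<comment> \<open>Differentiating \<open>S g = U\<close> and multiplying by the inverse of \<open>U\<close>.\<close>
  define Q where "Q = (if \<sigma> = 1 then imat_pow L1 p else imat_pow L2 p)"
  have VW: "W i j = V i j + of_int \<sigma> * Q i j" for i j
  proof -
    let ?P = "imat_pow cmv_shift p"
    let ?Y = "imat_transpose (Y x)"
    note hP = hess_pow[OF hess_cmv_shift, of p]
    have hY: "hess 0 (imat_transpose ?Y)" using Y by simp
    \<comment> \<open>the matrix \<open>\<sigma> g'\<close>\<close>
    define G where "G = (if \<sigma> = 1 then ?P \<odot> g x else g x \<odot> imat_transpose ?P)"
    have gP: "(g x \<odot> imat_transpose ?P) i j = g x i ((cmv_succ ^^ p) j)" for i j
    proof -
      have "(g x \<odot> imat_transpose ?P) i j = imat_transpose (?P \<odot> imat_transpose (g x)) i j"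
        by (simp add: imat_transpose_mult)
      then show ?thesis by (simp add: imat_transpose_def[of "_ \<odot> _"] cmv_shift_pow_mult imat_transpose_def[of "g x"])
    qed
    have "c x (cmv_exponent i - cmv_exponent j + \<sigma> * int p) = G i j" for i j
      using \<sigma> unfolding G_def
      by (auto simp: gP cmv_shift_pow_mult) (simp_all add: g_def cmv_matrix_def cmv_exponent_funpow algebra_simps)
    then have dg': "((\<lambda>s. g s i j) has_field_derivative of_int \<sigma> * G i j) (at x within R)" for i j
      using dg[of i j] by simp
    have SG: "(S x \<odot> (\<lambda>i j. of_int \<sigma> * G i j)) i j = of_int \<sigma> * (S x \<odot> G) i j" for i j
      by (simp add: hess_mult_eq_sum[OF S(1) order_refl] sum_distrib_left mult.left_commute)
    have "((\<lambda>s. (S s \<odot> g s) i j) has_field_derivative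
        (S' \<odot> g x) i j + of_int \<sigma> * (S x \<odot> G) i j) (at x within R)" for i j
      unfolding SG[symmetric] by (rule has_field_derivative_imat_mult[OF x S(1) S' dS dg'])
    moreover have "S s \<odot> g s = U s" for s
      unfolding S_def U_def by (rule lower_factor_imat_mult)
    ultimately have "((\<lambda>s. T s j i) has_field_derivative
        (S' \<odot> g x) i j + of_int \<sigma> * (S x \<odot> G) i j) (at x within R)" for i j
      by (simp add: T_def imat_transpose_def)
    then have "imat_transpose T' i j = (S' \<odot> g x) i j + of_int \<sigma> * (S x \<odot> G) i j" for i j
      unfolding imat_transpose_def by (rule has_field_derivative_unique_within[OF nontriv dT])
    then have W: "W i j = ((S' \<odot> g x) \<odot> ?Y) i j + of_int \<sigma> * ((S x \<odot> G) \<odot> ?Y) i j"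
      unfolding W_def by (rule imat_mult_add_outer[OF hY])
    have UY: "U x \<odot> ?Y = imat_one"
    proof -
      have "imat_transpose (Y x \<odot> T x) = imat_one" by (simp add: TY(2)[OF x])
      then show ?thesis by (simp add: imat_transpose_mult T_def)
    qed
    have SgU: "S x \<odot> g x = U x" unfolding S_def U_def by (rule lower_factor_imat_mult)
    have gY: "g x \<odot> ?Y = X x"
    proof -
      have "g x = X x \<odot> (S x \<odot> g x)"
        by (simp add: imat_mult_assoc_hess[OF X S(1), symmetric] SX)
      then have "g x \<odot> ?Y = (X x \<odot> U x) \<odot> ?Y" by (simp add: SgU)
      also have "\<dots> = X x \<odot> (U x \<odot> ?Y)" by (rule imat_mult_assoc_outer[OF X hY])
      finally show ?thesis by (simp add: UY)
    qed
    have 1: "(S' \<odot> g x) \<odot> ?Y = V"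
      unfolding V_def imat_mult_assoc_outer[OF S' hY] gY ..
    have 2: "(S x \<odot> G) \<odot> ?Y = Q"
    proof (cases "\<sigma> = 1")
      case True
      have "(S x \<odot> G) \<odot> ?Y = S x \<odot> ((?P \<odot> g x) \<odot> ?Y)"
        using True by (simp add: G_def imat_mult_assoc_outer[OF S(1) hY])
      also have "(?P \<odot> g x) \<odot> ?Y = ?P \<odot> X x"
        by (simp add: imat_mult_assoc_outer[OF hP hY] gY)
      also have "S x \<odot> (?P \<odot> X x) = imat_pow (S x \<odot> cmv_shift \<odot> X x) p"
        by (simp add: imat_pow_conjugate[OF S(1) X hess_cmv_shift SX(2,1)] imat_mult_assoc_hess[OF S(1) hP])
      finally show ?thesis using True by (simp add: Q_def L1_def lax1)
    next
      case False
      have hPt: "hess (p * 2) (imat_transpose (imat_transpose ?P))" using hP by simp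
      have "S x \<odot> G = U x \<odot> imat_transpose ?P"
        using False by (simp add: G_def imat_mult_assoc_outer[OF S(1) hPt, symmetric] SgU)
      then have "(S x \<odot> G) \<odot> ?Y = imat_transpose (Y x \<odot> (?P \<odot> T x))"
        by (simp add: imat_transpose_mult T_def)
      also have "Y x \<odot> (?P \<odot> T x) = imat_pow M p"
        by (simp add: M_def lax2 imat_mult_assoc_hess[OF Y hP]
            imat_pow_conjugate[OF Y T(1)[OF x] hess_cmv_shift TY[OF x]])
      also have "imat_transpose \<dots> = imat_pow L2 p"
        unfolding L2_pow[symmetric] by simp
      finally show ?thesis using False by (simp add: Q_def)
    qed
    show ?thesis using W by (simp only: 1 2)
  qed

  have hL1: "hess 2 L1" unfolding L1_def by (rule hess_lax1_of)
  have comV: "commutator V L1 i j = commutator B L1 i j"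
  proof (cases "\<sigma> = 1")
    case True
    have B: "B = upper_part Q" using True by (simp add: B_def Q_def L1_def)
    have hB: "hess (p * 2) B"
      using hess_pow[OF hL1, of p] True unfolding B Q_def upper_part_def by (simp add: hess_def)
    have "V = (\<lambda>i j. B i j - imat_pow L1 p i j)"
    proof (intro ext)
      fix i j
      show "V i j = B i j - imat_pow L1 p i j"
        using VW[of i j] V_strict[of i j] W_upper[of j i] True
        by (cases "i \<le> j") (auto simp: B upper_part_def Q_def eq_neg_iff_add_eq_0)
    qed
    then show ?thesis using commutator_diff_pow[OF hB hL1] by simp
  next
    case False
    have "V = B"
    proof (intro ext)
      fix i j
      show "V i j = B i j"
        using VW[of i j] V_strict[of i j] W_upper[of j i] False \<sigma>
        by (cases "i \<le> j") (auto simp: B_def strict_lower_part_def Q_def L2_def M_def)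
    qed
    then show ?thesis by simp
  qed
  have comW: "commutator W L2 i j = commutator B L2 i j"
  proof (cases "\<sigma> = 1")
    case True
    have "W = B"
    proof (intro ext)
      fix i j
      show "W i j = B i j"
        using VW[of i j] V_strict[of i j] W_upper[of j i] True
        by (cases "i \<le> j") (auto simp: B_def upper_part_def Q_def L1_def)
    qed
    then show ?thesis by simp
  next
    case False
    have B: "B = strict_lower_part Q" using False by (simp add: B_def Q_def L2_def M_def)
    have Qt: "imat_transpose Q = imat_pow M p"
      using L2_pow False by (simp add: Q_def)
    have hB: "hess (p * 2) (imat_transpose B)"
      using hess_pow[OF hM, of p] unfolding B Qt[symmetric] strict_lower_part_def
      by (simp add: hess_def imat_transpose_def)
    have "imat_transpose W = (\<lambda>i j. imat_transpose B i j - imat_pow M p i j)"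
    proof (intro ext)
      fix i j
      show "imat_transpose W i j = imat_transpose B i j - imat_pow M p i j"
        using VW[of j i] V_strict[of j i] W_upper[of i j] False \<sigma> unfolding Qt[symmetric]
        by (cases "j \<le> i") (auto simp: B imat_transpose_def strict_lower_part_def)
    qed
    then have "commutator (imat_transpose W) (imat_transpose L2) j i =
        commutator (imat_transpose B) (imat_transpose L2) j i"
      using commutator_diff_pow[OF hB hM] by (simp add: L2_def)
    then show ?thesis by (simp add: commutator_transpose)
  qed

  have "((\<lambda>s. (S s \<odot> cmv_shift \<odot> X s) i j) has_field_derivative
      commutator (S' \<odot> X x) (S x \<odot> cmv_shift \<odot> X x) i j) (at x within R)"
    by (rule conjugation_derivative(2)[OF x nontriv S(1) X SX dS S' dX hess_cmv_shift])
  then show "((\<lambda>s. lax1_of (c s) i j) has_field_derivative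
      commutator B (lax1_of (c x)) i j) (at x within R)"
    using comV by (simp add: lax1 V_def L1_def)

  have "((\<lambda>s. (Y s \<odot> cmv_shift \<odot> T s) j i) has_field_derivative
      commutator (Y' \<odot> T x) (Y x \<odot> cmv_shift \<odot> T x) j i) (at x within R)"
    by (rule conjugation_derivative(2)[OF x nontriv Y T(1) TY(2) TY(1)[OF x] dY Y' dT hess_cmv_shift])
  moreover have "commutator (Y' \<odot> T x) (Y x \<odot> cmv_shift \<odot> T x) j i = commutator W L2 i j"
  proof -
    have YT: "Y' \<odot> T x = (\<lambda>i j. - imat_transpose W i j)"
      unfolding Wt
      by (intro ext) (rule conjugation_derivative(1)[OF x nontriv Y T(1) TY(2) TY(1)[OF x] dY Y' dT hess_cmv_shift])
    have "commutator (\<lambda>i j. - imat_transpose W i j) M j i = - commutator (imat_transpose W) M j i"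
    proof -
      have h: "hess 0 (\<lambda>i j. - imat_transpose W i j)" using hWt by (simp add: hess_def)
      show ?thesis
        by (simp add: commutator_def hess_mult_eq_sum[OF h order_refl]
            hess_mult_eq_sum[OF hWt order_refl] hess_mult_eq_sum[OF hM order_refl] sum_negf)
    qed
    also have "\<dots> = commutator W L2 i j"
      using commutator_transpose[of W L2 j i] by (simp add: L2_def)
    finally show ?thesis by (simp add: YT M_def lax2)
  qed
  ultimately have "((\<lambda>s. lax2_transpose_of (c s) j i) has_field_derivative
      commutator B L2 i j) (at x within R)"
    using comW by (simp add: lax2)
  then show "((\<lambda>s. imat_transpose (lax2_transpose_of (c s)) i j) has_field_derivative
      commutator B (imat_transpose (lax2_transpose_of (c x))) i j) (at x within R)"
    by (simp only: imat_transpose_def[of "lax2_transpose_of (c _)" i j] L2_def M_def)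
qed

section \<open>Orthogonal polynomials on the circle\<close>

text \<open>The value of the moment functional \<open>z\<^sup>n \<mapsto> c n\<close> at \<open>p(z) z\<^sup>-\<^sup>k\<close>. The exponent \<open>k\<close> is an integer
because multiplication of \<open>p\<close> by \<open>z\<close> lowers it, and \<open>k = -1\<close> occurs.\<close>

definition pairing :: "(int \<Rightarrow> complex) \<Rightarrow> complex poly \<Rightarrow> int \<Rightarrow> complex" where
  "pairing c p k = (\<Sum>i\<le>degree p. coeff p i * c (int i - k))"

lemma pairing_eq_sum:
  assumes "degree p \<le> n"
  shows "pairing c p k = (\<Sum>i\<le>n. coeff p i * c (int i - k))"
  unfolding pairing_def
  by (rule sum.mono_neutral_left) (use assms in \<open>auto simp: coeff_eq_0\<close>)

lemma pairing_diff: "pairing c (p - q) k = pairing c p k - pairing c q k"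
proof -
  let ?n = "max (degree p) (degree q)"
  have "pairing c (p - q) k = (\<Sum>i\<le>?n. coeff (p - q) i * c (int i - k))"
    by (rule pairing_eq_sum) (rule degree_diff_le_max)
  also have "\<dots> = pairing c p k - pairing c q k"
    by (simp add: pairing_eq_sum[of p ?n] pairing_eq_sum[of q ?n] left_diff_distrib sum_subtractf)
  finally show ?thesis .
qed

lemma pairing_smult: "pairing c (Polynomial.smult a p) k = a * pairing c p k"
  by (simp add: pairing_eq_sum[of "Polynomial.smult a p" "degree p"] pairing_def sum_distrib_left mult.assoc
      degree_smult_le)

lemma pairing_pCons: "pairing c (pCons 0 p) k = pairing c p (k - 1)"
proof -
  have "pairing c (pCons 0 p) k = (\<Sum>i\<le>Suc (degree p). coeff (pCons 0 p) i * c (int i - k))"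
    by (rule pairing_eq_sum) (rule degree_pCons_le)
  also have "\<dots> = (\<Sum>i\<le>degree p. coeff p i * c (int i - (k - 1)))"
    by (simp add: sum.atMost_Suc_shift coeff_pCons algebra_simps del: sum.atMost_Suc)
  finally show ?thesis by (simp add: pairing_def)
qed

text \<open>The value of \<open>reflect_poly q\<close> at \<open>z\<close> is \<open>z\<^sup>l q(1/z)\<close> with \<open>l\<close> the degree of \<open>q\<close>; substituting \<open>1/z\<close>
for \<open>z\<close> reverses the moments.\<close>

lemma pairing_reflect:
  "pairing c (reflect_poly q) k = pairing (\<lambda>n. c (- n)) q (int (degree q) - k)"
proof -
  have "pairing c (reflect_poly q) k =
      (\<Sum>i\<le>degree q. coeff (reflect_poly q) i * c (int i - k))"
    by (rule pairing_eq_sum) (rule degree_reflect_poly_le)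
  also have "\<dots> = (\<Sum>i\<le>degree q. coeff q (degree q - i) * c (int i - k))"
    by (intro sum.cong refl) (simp add: coeff_reflect_poly)
  also have "\<dots> = (\<Sum>i\<le>degree q. coeff q i * c (int (degree q - i) - k))"
    by (rule sum.reindex_bij_witness[of _ "\<lambda>i. degree q - i" "\<lambda>i. degree q - i"]) auto
  also have "\<dots> = pairing (\<lambda>n. c (- n)) q (int (degree q) - k)"
    unfolding pairing_def by (intro sum.cong refl) (auto simp: algebra_simps of_nat_diff)
  finally show ?thesis .
qed

text \<open>Row \<open>l\<close> of the lower factor of the Toeplitz matrix is orthogonal to the first \<open>l\<close> powers, by the
triangularity of the upper factor.\<close>

definition szego :: "(int \<Rightarrow> complex) \<Rightarrow> nat \<Rightarrow> complex poly" where
  "szego c l = (\<Sum>i\<le>l. monom (lower_factor (toeplitz c) l i) i)"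

lemma coeff_szego: "coeff (szego c l) i = lower_factor (toeplitz c) l i"
  using lower_unitriangular_lower_factor[of "toeplitz c"]
  by (auto simp: szego_def coeff_sum lower_unitriangular_def if_distrib cong: if_cong)

lemma coeff_szego_top [simp]: "coeff (szego c l) l = 1"
  using lower_unitriangular_lower_factor[of "toeplitz c"]
  by (simp add: coeff_szego lower_unitriangular_def)

lemma degree_szego [simp]: "degree (szego c l) = l"
proof (rule antisym)
  show "degree (szego c l) \<le> l"
    using lower_unitriangular_lower_factor[of "toeplitz c"]
    by (intro degree_le) (auto simp: coeff_szego lower_unitriangular_def)
  show "l \<le> degree (szego c l)" by (rule le_degree) simp
qed

lemma pairing_szego: "pairing c (szego c l) (int k) = upper_factor (toeplitz c) l k"
  by (simp add: pairing_def coeff_szego factor_mult[OF order_refl] toeplitz_def)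

lemma szego_orthogonal:
  assumes "pivots_nonzero (toeplitz c) l" "0 \<le> k" "k < int l"
  shows "pairing c (szego c l) k = 0"
  using pairing_szego[of c l "nat k"] upper_factor_eq_0[OF assms(1), of "nat k"] assms(2,3)
  by simp

lemma orthogonal_eq_0:
  assumes "block_nonsingular (toeplitz c) n" "\<And>i. n \<le> i \<Longrightarrow> coeff p i = 0"
    and "\<And>k. k < n \<Longrightarrow> pairing c p (int k) = 0"
  shows "p = 0"
proof (cases n)
  case 0
  then show ?thesis using assms(2) by (simp add: poly_eq_iff)
next
  case (Suc m)
  have deg: "degree p \<le> m" using assms(2) Suc by (intro degree_le) auto
  have "\<forall>k<n. (\<Sum>i<n. coeff p i * toeplitz c i k) = 0"
    using assms(3) by (simp add: Suc lessThan_Suc_atMost pairing_eq_sum[OF deg] toeplitz_def)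
  then have "\<forall>i<n. coeff p i = 0"
    using assms(1) unfolding block_nonsingular_def by blast
  then show ?thesis using assms(2) by (metis leI leading_coeff_0_iff)
qed

lemma orthogonal_eq_smult_szego:
  assumes piv: "pivots_nonzero (toeplitz c) l" and deg: "degree p \<le> l"
    and orth: "\<And>k. 0 \<le> k \<Longrightarrow> k < int l \<Longrightarrow> pairing c p k = 0"
  shows "p = Polynomial.smult (coeff p l) (szego c l)"
proof -
  have "p - Polynomial.smult (coeff p l) (szego c l) = 0"
  proof (rule orthogonal_eq_0[OF nonsingular_if_pivots_nonzero[OF piv]])
    fix i assume "l \<le> i"
    then show "coeff (p - Polynomial.smult (coeff p l) (szego c l)) i = 0"
      using deg by (cases "i = l") (auto simp: coeff_eq_0)
  next
    fix k assume "k < l"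
    then show "pairing c (p - Polynomial.smult (coeff p l) (szego c l)) (int k) = 0"
      using orth szego_orthogonal[OF piv] by (simp add: pairing_diff pairing_smult)
  qed
  then show ?thesis by simp
qed

text \<open>Here \<open>P l\<close> and \<open>Q l\<close> are the two families of monic orthogonal polynomials (the second one with
conjugated coefficients), \<open>\<alpha>\<close> and \<open>\<beta>\<close> are their constant terms, and \<open>h l\<close> takes the place of the squared
norm of \<open>Q l\<close>. The
reversed polynomial \<open>z\<^sup>l Q\<^sub>l(1/z)\<close> is orthogonal to \<open>z, \<dots>, z\<^sup>l\<close>, where \<open>P l\<close> is orthogonal to
\<open>1, \<dots>, z\<^sup>l\<^sup>-\<^sup>1\<close>.\<close>

locale orthogonal_polynomials =
  fixes c :: "int \<Rightarrow> complex"
  assumes nondeg: "nondegenerate c"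
begin

abbreviation "c' \<equiv> \<lambda>n. c (- n)"
abbreviation "P \<equiv> szego c"
abbreviation "Q \<equiv> szego c'"

definition "\<alpha> l = coeff (P l) 0"
definition "\<beta> l = coeff (Q l) 0"
definition "h l = pairing c' (Q l) (int l)"

lemma pivots: "pivots_nonzero (toeplitz c) n" "pivots_nonzero (toeplitz c') n"
  using nondegenerate_toeplitz nondeg nondegenerate_reverse[OF nondeg]
  by (auto intro!: pivots_nonzero_if_nonsingular)

lemma h_nonzero: "h l \<noteq> 0"
  using pivots(2)[of "Suc l"] by (simp add: h_def pairing_szego pivots_nonzero_def)

lemma pairing_star:
  assumes "0 \<le> k" "k \<le> int l"
  shows "pairing c (reflect_poly (Q l)) k = (if k = 0 then h l else 0)"
  using assms szego_orthogonal[OF pivots(2)[of l], of "int l - k"]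
  by (auto simp: pairing_reflect h_def)

lemma coeff_star: "coeff (reflect_poly (Q l)) 0 = 1" "coeff (reflect_poly (Q l)) l = \<beta> l"
  by (simp_all add: coeff_reflect_poly \<beta>_def)

lemma orthogonal_eq_smult_star:
  assumes deg: "degree p \<le> l"
    and orth: "\<And>k. 1 \<le> k \<Longrightarrow> k \<le> int l \<Longrightarrow> pairing c p k = 0"
  shows "p = Polynomial.smult (coeff p 0) (reflect_poly (Q l))"
proof -
  let ?d = "p - Polynomial.smult (coeff p 0) (reflect_poly (Q l))"
  have "coeff ?d 0 = 0" by (simp add: coeff_star)
  then obtain r where r: "?d = pCons 0 r" by (cases ?d) (auto simp: coeff_pCons)
  have "r = 0"
  proof (rule orthogonal_eq_0[OF nondegenerate_toeplitz[OF nondeg]])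
    fix i assume "l \<le> i"
    have "coeff r i = coeff ?d (Suc i)" unfolding r by simp
    also have "\<dots> = 0" using deg \<open>l \<le> i\<close> by (simp add: coeff_eq_0 coeff_reflect_poly)
    finally show "coeff r i = 0" .
  next
    fix k assume "k < l"
    have "pairing c r (int k) = pairing c ?d (int k + 1)" unfolding r by (simp add: pairing_pCons)
    also have "\<dots> = 0"
      using orth[of "int k + 1"] \<open>k < l\<close> pairing_star[of "int k + 1" l]
      by (simp add: pairing_diff pairing_smult)
    finally show "pairing c r (int k) = 0" .
  qed
  then show ?thesis using r by simp
qed

text \<open>The polynomial \<open>P\<^sub>l\<^sub>+\<^sub>1 - z P\<^sub>l\<close> has degree at most \<open>l\<close> and is orthogonal to \<open>z, \<dots>, z\<^sup>l\<close>, so it is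
\<open>\<alpha>\<^sub>l\<^sub>+\<^sub>1\<close> times the reversed \<open>Q\<^sub>l\<close>; this is paired with \<open>1\<close>.\<close>

lemma szego_recursion: "pairing c (P l) (- 1) = - \<alpha> (Suc l) * h l"
proof -
  let ?d = "P (Suc l) - pCons 0 (P l)"
  have "degree ?d \<le> l"
  proof (rule degree_le, intro allI impI)
    fix i assume "l < i"
    then show "coeff ?d i = 0"
      by (cases "i = Suc l") (auto simp: coeff_eq_0 coeff_pCons split: nat.split)
  qed
  moreover have "pairing c ?d k = 0" if "1 \<le> k" "k \<le> int l" for k
    using that szego_orthogonal[OF pivots(1)[of "Suc l"], of k] szego_orthogonal[OF pivots(1)[of l], of "k - 1"]
    by (simp add: pairing_diff pairing_pCons)
  ultimately have d: "?d = Polynomial.smult (\<alpha> (Suc l)) (reflect_poly (Q l))"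
    using orthogonal_eq_smult_star[of ?d l] by (simp add: \<alpha>_def)
  have "pairing c ?d 0 = \<alpha> (Suc l) * h l"
    unfolding d by (simp add: pairing_smult pairing_star)
  then have "- pairing c (P l) (- 1) = \<alpha> (Suc l) * h l"
    using szego_orthogonal[OF pivots(1)[of "Suc l"], of 0] by (simp add: pairing_diff pairing_pCons)
  then show ?thesis by (metis minus_minus mult_minus_left)
qed

text \<open>The companion recursion: the reversed \<open>Q\<^sub>l\<^sub>+\<^sub>1\<close> minus the reversed \<open>Q\<^sub>l\<close> is \<open>\<beta>\<^sub>l\<^sub>+\<^sub>1 z P\<^sub>l\<close>. Pairing it with
\<open>1\<close> and inserting \<open>szego_recursion\<close> gives the ratio of consecutive \<open>h l\<close>.\<close>

lemma h_Suc: "h (Suc l) = h l * (1 - \<alpha> (Suc l) * \<beta> (Suc l))"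
proof -
  let ?d = "reflect_poly (Q (Suc l)) - reflect_poly (Q l)"
  have "coeff ?d 0 = 0" by (simp add: coeff_star)
  then obtain r where r: "?d = pCons 0 r" by (cases ?d) (auto simp: coeff_pCons)
  have cr: "coeff r i = coeff ?d (Suc i)" for i unfolding r by simp
  have "degree r \<le> l"
    by (rule degree_le) (simp add: cr coeff_reflect_poly)
  moreover have "pairing c r k = 0" if "0 \<le> k" "k < int l" for k
  proof -
    have "pairing c r k = pairing c ?d (k + 1)" unfolding r by (simp add: pairing_pCons)
    then show ?thesis
      using that pairing_star[of "k + 1" l] pairing_star[of "k + 1" "Suc l"] by (simp add: pairing_diff)
  qed
  ultimately have "r = Polynomial.smult (coeff r l) (P l)"
    by (rule orthogonal_eq_smult_szego[OF pivots(1)])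
  moreover have "coeff r l = \<beta> (Suc l)"
    by (simp add: cr coeff_star) (simp add: coeff_reflect_poly)
  ultimately have "pairing c r (- 1) = \<beta> (Suc l) * (- \<alpha> (Suc l) * h l)"
    by (metis pairing_smult szego_recursion)
  moreover have "pairing c ?d 0 = pairing c r (- 1)" unfolding r by (simp add: pairing_pCons)
  ultimately show ?thesis by (simp add: pairing_diff pairing_star algebra_simps)
qed

text \<open>The polynomial \<open>D\<close> stands for the derivative of \<open>P\<^sub>l\<^sub>+\<^sub>1\<close>, and the hypothesis is the differentiated
orthogonality. It makes \<open>D\<close> orthogonal to \<open>z, \<dots>, z\<^sup>l\<close>, so \<open>D\<close> is a multiple of the reversed \<open>Q\<^sub>l\<close>; the
factor comes from the pairing with \<open>1\<close>.\<close>

lemma alpha_flow: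
  assumes deg: "degree D \<le> l"
    and D: "\<And>k. 0 \<le> k \<Longrightarrow> k \<le> int l \<Longrightarrow> pairing c D k + \<epsilon> * pairing c (P (Suc l)) (k - 1) = 0"
  shows "coeff D 0 = \<epsilon> * \<alpha> (Suc (Suc l)) * (1 - \<alpha> (Suc l) * \<beta> (Suc l))"
proof -
  have "pairing c D k = 0" if "1 \<le> k" "k \<le> int l" for k
    using D[of k] that szego_orthogonal[OF pivots(1)[of "Suc l"], of "k - 1"] by simp
  with deg have "D = Polynomial.smult (coeff D 0) (reflect_poly (Q l))"
    by (rule orthogonal_eq_smult_star)
  then have "pairing c D 0 = coeff D 0 * h l"
    using pairing_star[of 0 l] by (metis order_refl of_nat_0_le_iff pairing_smult)
  then have "coeff D 0 * h l = \<epsilon> * \<alpha> (Suc (Suc l)) * h (Suc l)"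
    using D[of 0] szego_recursion[of "Suc l"] by (simp add: algebra_simps)
  then have "coeff D 0 * h l = (\<epsilon> * \<alpha> (Suc (Suc l)) * (1 - \<alpha> (Suc l) * \<beta> (Suc l))) * h l"
    by (simp add: h_Suc mult_ac)
  then show ?thesis using h_nonzero[of l] by simp
qed

text \<open>The polynomial \<open>E\<close> stands for the derivative of \<open>Q\<^sub>l\<^sub>+\<^sub>1\<close>. Reversing the moments changes the shift of
the exponent from \<open>-1\<close> to \<open>+1\<close>, so now \<open>E\<close> is orthogonal to the first \<open>l\<close> powers and a multiple of
\<open>Q\<^sub>l\<close> itself; the factor comes from the pairing with \<open>z\<^sup>l\<close>.\<close>

lemma beta_flow:
  assumes deg: "degree E \<le> l"
    and E: "\<And>k. 0 \<le> k \<Longrightarrow> k \<le> int l \<Longrightarrow> pairing c' E k + \<epsilon> * pairing c' (Q (Suc l)) (k + 1) = 0"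
  shows "coeff E 0 = - \<epsilon> * \<beta> l * (1 - \<alpha> (Suc l) * \<beta> (Suc l))"
proof -
  have "pairing c' E k = 0" if "0 \<le> k" "k < int l" for k
    using E[of k] that szego_orthogonal[OF pivots(2)[of "Suc l"], of "k + 1"] by simp
  with deg have E_eq: "E = Polynomial.smult (coeff E l) (Q l)"
    by (intro orthogonal_eq_smult_szego[OF pivots(2)]) auto
  then have "pairing c' E (int l) = coeff E l * h l"
    by (metis h_def pairing_smult)
  moreover have "pairing c' (Q (Suc l)) (int l + 1) = h (Suc l)"
    by (simp add: h_def add.commute)
  ultimately have "coeff E l * h l + \<epsilon> * h (Suc l) = 0"
    using E[of "int l"] by (simp only: of_nat_0_le_iff order_refl)
  then have "coeff E l * h l = (- \<epsilon> * (1 - \<alpha> (Suc l) * \<beta> (Suc l))) * h l"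
    by (simp add: h_Suc algebra_simps eq_neg_iff_add_eq_0)
  then have "coeff E l = - \<epsilon> * (1 - \<alpha> (Suc l) * \<beta> (Suc l))"
    using h_nonzero[of l] mult_right_cancel by blast
  moreover have "coeff E 0 = coeff E l * \<beta> l"
    using arg_cong[OF E_eq, of "\<lambda>p. coeff p 0"] by (simp add: \<beta>_def)
  ultimately show ?thesis by simp
qed

end

text \<open>A polynomial of fixed degree depends on finitely many pivots only, so it stays defined near a
quasi-definite parameter even if the deformed measure is not quasi-definite there.\<close>

lemma eventually_pivots_nonzero:
  assumes "\<And>i j. (\<lambda>s. G s i j) field_differentiable (at x)" and piv: "pivots_nonzero (G x) n"
  shows "\<forall>\<^sub>F s in nhds x. pivots_nonzero (G s) n"
proof -
  have "\<forall>\<^sub>F s in nhds x. upper_factor (G s) k k \<noteq> 0" if "k < n" for k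
  proof -
    have p: "pivots_nonzero (G x) k" and k: "upper_factor (G x) k k \<noteq> 0"
      using piv that by (auto simp: pivots_nonzero_def)
    have "(\<lambda>s. upper_factor (G s) k k) field_differentiable (at x)"
      unfolding upper_factor_def by (rule field_differentiable_elim(1)[OF assms(1) p])
    then have "isCont (\<lambda>s. upper_factor (G s) k k) x"
      by (rule field_differentiable_imp_continuous_at)
    then have "\<forall>\<^sub>F s in at x. upper_factor (G s) k k \<noteq> 0"
      unfolding isCont_def using k by (rule tendsto_imp_eventually_ne)
    then show ?thesis using k by (simp add: eventually_nhds_conv_at)
  qed
  then have "\<forall>\<^sub>F s in nhds x. \<forall>k\<in>{..<n}. upper_factor (G s) k k \<noteq> 0"
    by (intro eventually_ball_finite) auto
  then show ?thesis by (simp add: pivots_nonzero_def Ball_def)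
qed

lemma szego_derivative:
  fixes c :: "complex \<Rightarrow> int \<Rightarrow> complex"
  assumes dc: "\<And>n. ((\<lambda>s. c s n) has_field_derivative \<epsilon> * c x (n + \<delta>)) (at x)"
    and piv: "pivots_nonzero (toeplitz (c x)) (Suc l)"
  obtains D where "degree D \<le> l"
    "\<And>i. ((\<lambda>s. coeff (szego (c s) (Suc l)) i) has_field_derivative coeff D i) (at x)"
    "\<And>k. 0 \<le> k \<Longrightarrow> k \<le> int l \<Longrightarrow>
      pairing (c x) D k + \<epsilon> * pairing (c x) (szego (c x) (Suc l)) (k - \<delta>) = 0"
proof -
  have diff: "(\<lambda>s. toeplitz (c s) i j) field_differentiable (at x)" for i j
    using dc unfolding toeplitz_def field_differentiable_def by blast
  have "(\<lambda>s. coeff (szego (c s) (Suc l)) i) field_differentiable (at x)" for i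
    unfolding coeff_szego lower_factor_def by (rule field_differentiable_elim(2)[OF diff piv])
  then have "\<forall>i. \<exists>d. ((\<lambda>s. coeff (szego (c s) (Suc l)) i) has_field_derivative d) (at x)"
    by (simp add: field_differentiable_def)
  then obtain d where d: "\<And>i. ((\<lambda>s. coeff (szego (c s) (Suc l)) i) has_field_derivative d i) (at x)"
    by metis
  have d0: "d i = 0" if "l < i" for i
  proof -
    have "coeff (szego (c s) (Suc l)) i = (if i = Suc l then 1 else 0)" for s
      using that by (auto simp: coeff_eq_0)
    then show ?thesis using d[of i] DERIV_unique[OF _ DERIV_const] by simp
  qed
  define D where "D = (\<Sum>i\<le>l. monom (d i) i)"
  have cD: "coeff D i = d i" for i
    using d0[of i] by (auto simp: D_def coeff_sum if_distrib cong: if_cong)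
  have degD: "degree D \<le> l" by (rule degree_le) (simp add: cD d0)
  have "pairing (c x) D k + \<epsilon> * pairing (c x) (szego (c x) (Suc l)) (k - \<delta>) = 0"
    if k: "0 \<le> k" "k \<le> int l" for k
  proof -
    have "((\<lambda>s. \<Sum>i\<le>Suc l. coeff (szego (c s) (Suc l)) i * c s (int i - k)) has_field_derivative
        (\<Sum>i\<le>Suc l. d i * c x (int i - k) + \<epsilon> * c x (int i - k + \<delta>) * coeff (szego (c x) (Suc l)) i)) (at x)"
      by (rule DERIV_sum) (rule DERIV_mult[OF d dc])
    moreover have "(\<Sum>i\<le>Suc l. d i * c x (int i - k) + \<epsilon> * c x (int i - k + \<delta>) * coeff (szego (c x) (Suc l)) i) =
        pairing (c x) D k + \<epsilon> * pairing (c x) (szego (c x) (Suc l)) (k - \<delta>)"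
    proof -
      have "pairing (c x) D k = (\<Sum>i\<le>Suc l. d i * c x (int i - k))"
        using degD by (subst pairing_eq_sum[of D "Suc l"]) (auto simp: cD)
      moreover have "pairing (c x) (szego (c x) (Suc l)) (k - \<delta>) =
          (\<Sum>i\<le>Suc l. coeff (szego (c x) (Suc l)) i * c x (int i - k + \<delta>))"
        by (simp add: pairing_def algebra_simps)
      ultimately show ?thesis by (simp only: sum.distrib sum_distrib_left mult_ac)
    qed
    ultimately have "((\<lambda>s. pairing (c s) (szego (c s) (Suc l)) k) has_field_derivative
        pairing (c x) D k + \<epsilon> * pairing (c x) (szego (c x) (Suc l)) (k - \<delta>)) (at x)"
      by (simp only: pairing_def degree_szego)
    moreover have "((\<lambda>s. pairing (c s) (szego (c s) (Suc l)) k) has_field_derivative 0) (at x)"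
    proof -
      have "\<forall>\<^sub>F s in nhds x. pairing (c s) (szego (c s) (Suc l)) k = 0"
        using eventually_pivots_nonzero[OF diff piv]
        by (rule eventually_mono) (use k in \<open>simp add: szego_orthogonal\<close>)
      then show ?thesis
        using DERIV_cong_ev[OF refl _ refl, of "\<lambda>s. pairing (c s) (szego (c s) (Suc l)) k" "\<lambda>_. 0" x 0]
        by simp
    qed
    ultimately show ?thesis by (rule DERIV_unique)
  qed
  with degD show thesis using that[of D] d by (simp add: cD)
qed

lemma ablowitz_ladik:
  fixes c :: "complex \<Rightarrow> int \<Rightarrow> complex"
  assumes nd: "nondegenerate (c x)"
    and dc: "\<And>n. ((\<lambda>s. c s n) has_field_derivative \<epsilon> * c x (n + 1)) (at x)"
  defines "a \<equiv> \<lambda>l s. coeff (szego (c s) l) 0" and "b \<equiv> \<lambda>l s. coeff (szego (\<lambda>n. c s (- n)) l) 0"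
  assumes l: "1 \<le> l"
  shows "((\<lambda>s. a l s) has_field_derivative \<epsilon> * a (l + 1) x * (1 - a l x * b l x)) (at x)"
    and "((\<lambda>s. b l s) has_field_derivative - \<epsilon> * b (l - 1) x * (1 - a l x * b l x)) (at x)"
proof -
  interpret orthogonal_polynomials "c x" by standard (rule nd)
  have ab: "a m x = \<alpha> m" "b m x = \<beta> m" for m
    by (simp_all add: a_def b_def \<alpha>_def \<beta>_def)
  obtain m where m: "l = Suc m" using l by (cases l) auto
  have dc': "((\<lambda>s. c s (- n)) has_field_derivative \<epsilon> * c x (- (n + (- 1)))) (at x)" for n
    using dc[of "- n"] by simp
  obtain D where D: "degree D \<le> m"
    "\<And>i. ((\<lambda>s. coeff (szego (c s) (Suc m)) i) has_field_derivative coeff D i) (at x)"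
    "\<And>k. 0 \<le> k \<Longrightarrow> k \<le> int m \<Longrightarrow>
      pairing (c x) D k + \<epsilon> * pairing (c x) (szego (c x) (Suc m)) (k - 1) = 0"
    by (rule szego_derivative[OF dc pivots(1)]) blast
  show "((\<lambda>s. a l s) has_field_derivative \<epsilon> * a (l + 1) x * (1 - a l x * b l x)) (at x)"
  proof -
    have "coeff D 0 = \<epsilon> * a (l + 1) x * (1 - a l x * b l x)"
      using alpha_flow[OF D(1,3)] by (simp add: ab m)
    then show ?thesis using D(2)[of 0] by (simp only: a_def m)
  qed
  obtain E where E: "degree E \<le> m"
    "\<And>i. ((\<lambda>s. coeff (szego (\<lambda>n. c s (- n)) (Suc m)) i) has_field_derivative coeff E i) (at x)"
    "\<And>k. 0 \<le> k \<Longrightarrow> k \<le> int m \<Longrightarrow> pairing (\<lambda>n. c x (- n)) E k +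
      \<epsilon> * pairing (\<lambda>n. c x (- n)) (szego (\<lambda>n. c x (- n)) (Suc m)) (k - (- 1)) = 0"
    by (rule szego_derivative[where c = "\<lambda>s n. c s (- n)", OF dc' pivots(2)]) blast
  show "((\<lambda>s. b l s) has_field_derivative - \<epsilon> * b (l - 1) x * (1 - a l x * b l x)) (at x)"
  proof -
    have "coeff E 0 = - \<epsilon> * b (l - 1) x * (1 - a l x * b l x)"
      using beta_flow[OF E(1), of \<epsilon>] E(3) by (simp add: ab m)
    then show ?thesis using E(2)[of 0] by (simp only: b_def m)
  qed
qed

section \<open>Verblunsky coefficients of a measure\<close>

lemma quasi_definite_moment: "quasi_definite \<nu> \<longleftrightarrow> nondegenerate (moment \<nu>)"
  by (simp add: quasi_definite_def nondegenerate_def moment_def)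

lemma cmv_moment_eq:
  assumes "sets m = sets circle" "has_density m \<nu> h"
  shows "cmv_moment \<nu> = cmv_matrix (moment \<nu>)"
proof (intro ext)
  fix i j
  have chi: "cmv_chi z i = z powi cmv_exponent i" for z i
    by (cases "even i") (simp_all only: cmv_chi_def cmv_exponent_def if_True if_False
        power_int_minus power_int_of_nat power_inverse simp_thms)
  have "cmv_chi z i * cnj (cmv_chi z j) = (\<Sum>k\<in>{()}. 1 * z powi (cmv_exponent i - cmv_exponent j))"
    if z: "norm z = 1" for z
  proof -
    have "z \<noteq> 0" using z by auto
    have "cnj z = inverse z"
      using z complex_norm_square[of z] by (intro inverse_unique[symmetric]) simp
    then have "cnj (z powi cmv_exponent j) = z powi (- cmv_exponent j)"
      by (simp add: power_int_def power_inverse)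
    then show ?thesis using \<open>z \<noteq> 0\<close> by (simp add: chi power_int_diff power_int_minus divide_inverse)
  qed
  then have "cmv_moment \<nu> i j = (\<Sum>k\<in>{()}. 1 * moment \<nu> (cmv_exponent i - cmv_exponent j))"
    unfolding cmv_moment_def by (intro circle_integral_laurent[OF assms]) auto
  then show "cmv_moment \<nu> i j = cmv_matrix (moment \<nu>) i j" by (simp add: cmv_matrix_def)
qed

lemma monic_orthogonal_iff_szego:
  assumes "pivots_nonzero (toeplitz c) l"
  shows "degree p = l \<and> lead_coeff p = 1 \<and> (\<forall>k<l. pairing c p (int k) = 0) \<longleftrightarrow> p = szego c l"
proof
  assume p: "degree p = l \<and> lead_coeff p = 1 \<and> (\<forall>k<l. pairing c p (int k) = 0)"
  have "pairing c p k = 0" if "0 \<le> k" "k < int l" for k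
    using p that nonneg_int_cases[OF that(1)] by (metis of_nat_less_iff)
  then have "p = Polynomial.smult (coeff p l) (szego c l)"
    using p by (intro orthogonal_eq_smult_szego[OF assms]) auto
  moreover have "coeff p l = 1" using p by auto
  ultimately show "p = szego c l" by (metis smult_1_left)
qed (use szego_orthogonal[OF assms] in auto)

lemma verblunsky1_eq:
  assumes dens: "sets m = sets circle" "has_density m \<nu> h"
    and piv: "pivots_nonzero (toeplitz (moment \<nu>)) l"
  shows "verblunsky1 \<nu> l = coeff (szego (moment \<nu>) l) 0"
proof -
  have "circle_integral \<nu> (\<lambda>z. poly p z * inverse z ^ k) = pairing (moment \<nu>) p (int k)" for p k
    unfolding pairing_def
  proof (rule circle_integral_laurent[OF dens])
    fix z :: complex assume "norm z = 1"
    then have "z \<noteq> 0" by auto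
    then have "z ^ i * inverse z ^ k = z powi (int i - int k)" for i
      by (simp add: power_int_diff power_inverse divide_inverse)
    then show "poly p z * inverse z ^ k = (\<Sum>i\<le>degree p. coeff p i * z powi (int i - int k))"
      by (simp add: poly_altdef sum_distrib_right mult.assoc)
  qed simp
  then have "szego_poly1 \<nu> l = szego (moment \<nu>) l"
    by (simp add: szego_poly1_def monic_orthogonal_iff_szego[OF piv])
  then show ?thesis by (simp add: verblunsky1_def poly_0_coeff_0)
qed

lemma verblunsky2_eq:
  assumes dens: "sets m = sets circle" "has_density m \<nu> h"
    and piv: "pivots_nonzero (toeplitz (\<lambda>n. moment \<nu> (- n))) l"
  shows "cnj (verblunsky2 \<nu> l) = coeff (szego (\<lambda>n. moment \<nu> (- n)) l) 0"
proof -
  let ?c = "\<lambda>n. moment \<nu> (- n)" and ?b = "map_poly cnj"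
  have int: "circle_integral \<nu> (\<lambda>z. z ^ k * poly q (inverse z)) = pairing ?c q (int k)" for q k
    unfolding pairing_def
  proof (rule circle_integral_laurent[OF dens])
    fix z :: complex assume "norm z = 1"
    then have "z \<noteq> 0" by auto
    then have "z ^ k * inverse z ^ i = z powi (- (int i - int k))" for i
      by (simp add: power_int_diff power_inverse divide_inverse)
    then show "z ^ k * poly q (inverse z) = (\<Sum>i\<le>degree q. coeff q i * z powi (- (int i - int k)))"
      by (simp add: poly_altdef sum_distrib_left mult.left_commute)
  qed simp
  have deg: "degree (?b p) = degree p" for p by (intro degree_map_poly) simp
  have cf: "coeff (?b p) i = cnj (coeff p i)" for p i by (simp add: coeff_map_poly)
  have invol: "?b (?b p) = p" for p by (simp add: poly_eq_iff cf)
  have "(degree p = l \<and> lead_coeff p = 1 \<and>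
      (\<forall>k<l. circle_integral \<nu> (\<lambda>z. z ^ k * poly (?b p) (inverse z)) = 0)) \<longleftrightarrow> p = ?b (szego ?c l)" for p
  proof -
    have "(degree p = l \<and> lead_coeff p = 1 \<and>
        (\<forall>k<l. circle_integral \<nu> (\<lambda>z. z ^ k * poly (?b p) (inverse z)) = 0)) \<longleftrightarrow>
      (degree (?b p) = l \<and> lead_coeff (?b p) = 1 \<and> (\<forall>k<l. pairing ?c (?b p) (int k) = 0))"
      by (simp only: int deg cf complex_cnj_one_iff)
    also have "\<dots> \<longleftrightarrow> ?b p = szego ?c l" by (rule monic_orthogonal_iff_szego[OF piv])
    also have "\<dots> \<longleftrightarrow> p = ?b (szego ?c l)" by (metis invol)
    finally show ?thesis .
  qed
  then have "szego_poly2 \<nu> l = ?b (szego ?c l)" by (simp add: szego_poly2_def)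
  then show ?thesis by (simp add: verblunsky2_def poly_0_coeff_0 cf)
qed

section \<open>The CMV flows\<close>

theorem proposition28:
  fixes \<mu> :: "complex set \<Rightarrow> complex"
    and t :: "nat \<Rightarrow> nat \<Rightarrow> complex"
    and \<alpha>1 \<alpha>2_bar :: "nat \<Rightarrow> (nat \<Rightarrow> nat \<Rightarrow> complex) \<Rightarrow> complex"
  defines "\<alpha>1 \<equiv> \<lambda>k t. verblunsky1 (deformed \<mu> t) k"
    and "\<alpha>2_bar \<equiv> \<lambda>k t. cnj (verblunsky2 (deformed \<mu> t) k)"
  assumes "complex_measure circle \<mu>"
    and "quasi_definite \<mu>"
    and "t \<in> param_range \<mu>"
  shows "lax_equations \<mu> t \<and>
    (\<forall>k\<ge>1.
      ((\<lambda>s. \<alpha>1 k (set_param t 1 1 s)) has_field_derivative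
        \<alpha>1 (k + 1) t * (1 - \<alpha>1 k t * \<alpha>2_bar k t)) (at (t 1 1)) \<and>
      ((\<lambda>s. \<alpha>2_bar k (set_param t 1 1 s)) has_field_derivative
        - \<alpha>2_bar (k - 1) t * (1 - \<alpha>1 k t * \<alpha>2_bar k t)) (at (t 1 1)) \<and>
      ((\<lambda>s. \<alpha>1 k (set_param t 2 1 s)) has_field_derivative
        \<alpha>1 (k - 1) t * (1 - \<alpha>1 k t * \<alpha>2_bar k t)) (at (t 2 1)) \<and>
      ((\<lambda>s. \<alpha>2_bar k (set_param t 2 1 s)) has_field_derivative
        - \<alpha>2_bar (k + 1) t * (1 - \<alpha>1 k t * \<alpha>2_bar k t)) (at (t 2 1)))"
proof -
  obtain m h where m: "sets m = sets circle" and dens: "has_density m \<mu> h"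
    by (rule complex_measure_has_density[OF assms(3)])
  have t: "admissible t" and nd: "nondegenerate (moment (deformed \<mu> t))"
    using assms(5) by (auto simp: param_range_def quasi_definite_moment)
  define c where "c b j s = moment (deformed \<mu> (set_param t b j s))" for b j s
  have c_t [simp]: "c b j (t b j) = moment (deformed \<mu> t)" for b j by (simp add: c_def)
  have dens_s: "has_density m (deformed \<mu> (set_param t b j s)) (\<lambda>z. weight (set_param t b j s) z * h z)"
    for b j s
    by (rule deformed_has_density[OF m dens admissible_set_param[OF t]])
  have dc: "((\<lambda>s. c b j s n) has_field_derivative
      of_int (flow_sign b) * c b j (t b j) (n + flow_sign b * int j)) (at (t b j) within R)"
    if "b \<in> {1, 2}" "1 \<le> j" for b j n R
    unfolding c_t unfolding c_def
    by (rule has_field_derivative_at_within[OF has_field_derivative_moment[OF m dens t that]])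

  \<comment> \<open>If \<open>t b j\<close> is isolated in the range of the parameter, the derivative within the range is
    unconstrained; otherwise \<open>lax_derivative\<close> applies.\<close>
  have "lax_equations \<mu> t"
    unfolding lax_equations_def
  proof (intro ballI allI impI)
    fix a b j p q :: nat
    assume a: "a \<in> {1, 2}" and b: "b \<in> {1, 2}" and j: "1 \<le> j"
    let ?x = "t b j" and ?R = "{s. set_param t b j s \<in> param_range \<mu>}"
    show "((\<lambda>s. lax a (deformed \<mu> (set_param t b j s)) p q) has_field_derivative
        commutator (lax_B b j (deformed \<mu> t)) (lax a (deformed \<mu> t)) p q) (at ?x within ?R)"
    proof (cases "at ?x within ?R = bot")
      case False
      have x: "?x \<in> ?R" using assms(5) by simp
      have nds: "nondegenerate (c b j s)" if "s \<in> ?R" for s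
        using that by (simp add: param_range_def quasi_definite_moment c_def)
      have lax: "lax1 (deformed \<mu> (set_param t b j s)) = lax1_of (c b j s)"
        "lax2 (deformed \<mu> (set_param t b j s)) = imat_transpose (lax2_transpose_of (c b j s))"
        if "s \<in> ?R" for s
        using lax_eq[OF cmv_moment_eq[OF m dens_s, of b j s]] nds[OF that] by (simp_all add: c_def)
      have sgn: "flow_sign b = 1 \<or> flow_sign b = - 1" by (simp add: flow_sign_def)
      have B: "lax_B b j (deformed \<mu> t) =
          (if flow_sign b = 1 then upper_part (imat_pow (lax1_of (c b j ?x)) j)
           else strict_lower_part (imat_pow (imat_transpose (lax2_transpose_of (c b j ?x))) j))"
        using lax[OF x] by (simp add: lax_B_def flow_sign_def)
      note D = lax_derivative[where c = "c b j", OF x False nds dc[OF b j] sgn, folded B]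
      show ?thesis
      proof (cases "a = 1")
        case True
        have eq: "lax1_of (c b j s) p q = lax a (deformed \<mu> (set_param t b j s)) p q" if "s \<in> ?R" for s
          unfolding lax(1)[OF that, symmetric] True by (simp add: lax_def)
        have "lax a (deformed \<mu> t) = lax1_of (c b j ?x)"
          using lax(1)[OF x] True by (simp add: lax_def)
        then show ?thesis
          by (simp only:) (rule has_field_derivative_eq_on[OF D(1) x eq])
      next
        case False
        have eq: "imat_transpose (lax2_transpose_of (c b j s)) p q =
            lax a (deformed \<mu> (set_param t b j s)) p q" if "s \<in> ?R" for s
          unfolding lax(2)[OF that, symmetric] using False by (simp add: lax_def)
        have "lax a (deformed \<mu> t) = imat_transpose (lax2_transpose_of (c b j ?x))"
          using lax(2)[OF x] False by (simp add: lax_def)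
        then show ?thesis
          by (simp only:) (rule has_field_derivative_eq_on[OF D(2) x eq])
      qed
    qed simp
  qed

  moreover have
    "((\<lambda>s. \<alpha>1 k (set_param t 1 1 s)) has_field_derivative
        \<alpha>1 (k + 1) t * (1 - \<alpha>1 k t * \<alpha>2_bar k t)) (at (t 1 1)) \<and>
     ((\<lambda>s. \<alpha>2_bar k (set_param t 1 1 s)) has_field_derivative
        - \<alpha>2_bar (k - 1) t * (1 - \<alpha>1 k t * \<alpha>2_bar k t)) (at (t 1 1)) \<and>
     ((\<lambda>s. \<alpha>1 k (set_param t 2 1 s)) has_field_derivative
        \<alpha>1 (k - 1) t * (1 - \<alpha>1 k t * \<alpha>2_bar k t)) (at (t 2 1)) \<and>
     ((\<lambda>s. \<alpha>2_bar k (set_param t 2 1 s)) has_field_derivative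
        - \<alpha>2_bar (k + 1) t * (1 - \<alpha>1 k t * \<alpha>2_bar k t)) (at (t 2 1))"
    if k: "1 \<le> k" for k
  proof -
    define A where "A b l s = coeff (szego (c b 1 s) l) 0" for b l s
    define A' where "A' b l s = coeff (szego (\<lambda>n. c b 1 s (- n)) l) 0" for b l s
    note nd' = nondegenerate_reverse[OF nd]
    have piv: "pivots_nonzero (toeplitz (moment (deformed \<mu> t))) l"
      "pivots_nonzero (toeplitz (\<lambda>n. moment (deformed \<mu> t) (- n))) l" for l
      using nondegenerate_toeplitz[OF nd] nondegenerate_toeplitz[OF nd']
      by (auto intro!: pivots_nonzero_if_nonsingular)
    have dc1: "((\<lambda>s. c b 1 s n) has_field_derivative
        of_int (flow_sign b) * c b 1 (t b 1) (n + flow_sign b)) (at (t b 1))" if "b \<in> {1, 2}" for b n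
      using dc[OF that order_refl, of n UNIV] by simp
    have diff: "(\<lambda>s. toeplitz (c b 1 s) i j) field_differentiable (at (t b 1))"
      "(\<lambda>s. toeplitz (\<lambda>n. c b 1 s (- n)) i j) field_differentiable (at (t b 1))" if "b \<in> {1, 2}" for b i j
      unfolding toeplitz_def field_differentiable_def by (rule exI, rule dc1[OF that])+
    \<comment> \<open>The derivatives are not restricted to the quasi-definite range; near \<open>t b 1\<close> the first \<open>k\<close> pivots
      suffice to identify the Verblunsky coefficients.\<close>
    have ev: "\<forall>\<^sub>F s in nhds (t b 1). \<alpha>1 k (set_param t b 1 s) = A b k s"
      "\<forall>\<^sub>F s in nhds (t b 1). \<alpha>2_bar k (set_param t b 1 s) = A' b k s" if b: "b \<in> {1, 2}" for b
    proof -
      have "\<forall>\<^sub>F s in nhds (t b 1). pivots_nonzero (toeplitz (c b 1 s)) k"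
        by (rule eventually_pivots_nonzero[OF diff(1)[OF b]]) (simp add: piv)
      then show "\<forall>\<^sub>F s in nhds (t b 1). \<alpha>1 k (set_param t b 1 s) = A b k s"
        by (rule eventually_mono)
          (simp add: \<alpha>1_def A_def c_def verblunsky1_eq[OF m dens_s])
      have "\<forall>\<^sub>F s in nhds (t b 1). pivots_nonzero (toeplitz (\<lambda>n. c b 1 s (- n))) k"
        by (rule eventually_pivots_nonzero[OF diff(2)[OF b]]) (simp add: piv)
      then show "\<forall>\<^sub>F s in nhds (t b 1). \<alpha>2_bar k (set_param t b 1 s) = A' b k s"
        by (rule eventually_mono)
          (simp add: \<alpha>2_bar_def A'_def c_def verblunsky2_eq[OF m dens_s])
    qed
    have at_t: "\<alpha>1 l t = A b l (t b 1)" "\<alpha>2_bar l t = A' b l (t b 1)" for b l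
      using verblunsky1_eq[OF m deformed_has_density[OF m dens t] piv(1)]
        verblunsky2_eq[OF m deformed_has_density[OF m dens t] piv(2)]
      by (simp_all add: \<alpha>1_def \<alpha>2_bar_def A_def A'_def)
    have nd1: "nondegenerate (c b 1 (t b 1))" for b using nd by simp
    have nd2: "nondegenerate (\<lambda>n. c b 1 (t b 1) (- n))" for b using nd' by simp
    have plus: "((\<lambda>s. c 1 1 s n) has_field_derivative 1 * c 1 1 (t 1 1) (n + 1)) (at (t 1 1))" for n
      using dc1[of 1 n] by (simp add: flow_sign_def)
    \<comment> \<open>For the second flow the reversed moments play the role of \<open>c\<close>, with the sign \<open>- 1\<close>.\<close>
    have minus: "((\<lambda>s. c 2 1 s (- n)) has_field_derivative (- 1) * c 2 1 (t 2 1) (- (n + 1))) (at (t 2 1))" for n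
      using dc1[of 2 "- n"] by (simp add: flow_sign_def)
    have flow1:
      "(A 1 k has_field_derivative A 1 (k + 1) (t 1 1) * (1 - A 1 k (t 1 1) * A' 1 k (t 1 1))) (at (t 1 1))"
      "(A' 1 k has_field_derivative - A' 1 (k - 1) (t 1 1) * (1 - A 1 k (t 1 1) * A' 1 k (t 1 1))) (at (t 1 1))"
      using ablowitz_ladik[where c = "c 1 1", OF nd1 plus k] by (simp_all add: A_def[abs_def] A'_def[abs_def])
    have flow2:
      "(A 2 k has_field_derivative A 2 (k - 1) (t 2 1) * (1 - A 2 k (t 2 1) * A' 2 k (t 2 1))) (at (t 2 1))"
      "(A' 2 k has_field_derivative - A' 2 (k + 1) (t 2 1) * (1 - A 2 k (t 2 1) * A' 2 k (t 2 1))) (at (t 2 1))"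
      using ablowitz_ladik[where c = "\<lambda>s n. c 2 1 s (- n)", OF nd2 minus k]
      by (simp_all add: A_def[abs_def] A'_def[abs_def] mult.commute)
    have transfer: "((\<lambda>s. \<alpha>1 k (set_param t b 1 s)) has_field_derivative D) (at (t b 1)) \<longleftrightarrow>
        (A b k has_field_derivative D) (at (t b 1))"
      "((\<lambda>s. \<alpha>2_bar k (set_param t b 1 s)) has_field_derivative D) (at (t b 1)) \<longleftrightarrow>
        (A' b k has_field_derivative D) (at (t b 1))" if "b \<in> {1, 2}" for b D
      by (rule DERIV_cong_ev[OF refl ev(1)[OF that] refl], rule DERIV_cong_ev[OF refl ev(2)[OF that] refl])
    note one = insertI1[of "1::nat" "{2}"] and two = insertI2[OF singletonI, of "2::nat" 1]
    show ?thesis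
      using iffD2[OF transfer(1)[OF one] flow1(1)[folded at_t[of _ 1]]]
        iffD2[OF transfer(2)[OF one] flow1(2)[folded at_t[of _ 1]]]
        iffD2[OF transfer(1)[OF two] flow2(1)[folded at_t[of _ 2]]]
        iffD2[OF transfer(2)[OF two] flow2(2)[folded at_t[of _ 2]]]
      by (intro conjI)
  qed
  ultimately show ?thesis by blast
qed

end
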